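(* For an integer $n>1$, let $K_n^0$ denote the largest number such that, for every holomorphic function $f(z)=\sum_{\alpha}c_\alpha z^\alpha$ on the unit polydisk $\mathbb{D}^n$ with $f(0)=0$ and $|f(z)|<1$ for all $z\in\mathbb{D}^n$, the inequality $$\sum_{k=1}^{\infty}\sum_{|\alpha|=k}|c_\alpha z^\alpha|\le 1$$ holds for all $z\in K_n^0\cdot\mathbb{D}^n$. Then for every $n>1$, $$K_n^0\ge\frac{1}{\sqrt{2n}},$$ and $$K_n^0\le\begin{cases}\dfrac1{\sqrt2}, & n=2,\\[2mm] \dfrac{2\sqrt{\log n}}{\sqrt n}, & n>2.\end{cases}$$
   Context: $\mathbb{D}^n=\{z=(z_1,\ldots,z_n)\in\mathbb{C}^n: |z_j|<1,\ j=1,\ldots,n\}$ is the open unit polydisk, and $\rho\cdot\mathbb{D}^n=\{\rho z: z\in\mathbb{D}^n\}$. Multi-index notation: $\alpha=(\alpha_1,\ldots,\alpha_n)$ is an $n$-tuple of non-negative integers, $|\alpha|=\alpha_1+\cdots+\alpha_n$, $z^\alpha=z_1^{\alpha_1}\cdots z_n^{\alpha_n}$, and $\sum_\alpha c_\alpha z^\alpha$ is the Taylor series of $f$ at $0$. *)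

theory Defs
  imports "HOL-Complex_Analysis.Complex_Analysis"
begin

definition polydisk :: "(complex ^ 'n) set" where
  "polydisk = {z. \<forall>j. norm (z $ j) < 1}"

text \<open>
  Holomorphy in several variables is complex Frechet differentiability: the real
  derivative exists and is complex-linear.
\<close>

definition multi_holomorphic_on :: "(complex ^ 'n \<Rightarrow> complex) \<Rightarrow> (complex ^ 'n) set \<Rightarrow> bool"
  (infixl \<open>multi'_holomorphic'_on\<close> 50) where
  "f multi_holomorphic_on U \<longleftrightarrow>
     (\<forall>z\<in>U. \<exists>L. (f has_derivative L) (at z within U) \<and> Vector_Spaces.linear (*s) (*) L)"

text \<open>Multi-indices are functions \<open>'n \<Rightarrow> nat\<close>.\<close>

definition mi_deg :: "('n::finite \<Rightarrow> nat) \<Rightarrow> nat" where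
  "mi_deg \<alpha> = (\<Sum>j\<in>UNIV. \<alpha> j)"

definition mi_fact :: "('n::finite \<Rightarrow> nat) \<Rightarrow> nat" where
  "mi_fact \<alpha> = (\<Prod>j\<in>UNIV. fact (\<alpha> j))"

definition mi_power :: "complex ^ 'n \<Rightarrow> ('n \<Rightarrow> nat) \<Rightarrow> complex" where
  "mi_power z \<alpha> = (\<Prod>j\<in>UNIV. (z $ j) ^ \<alpha> j)"

lemma finite_mi_deg_eq: "finite {\<alpha> :: 'n::finite \<Rightarrow> nat. mi_deg \<alpha> = k}"
proof (rule finite_subset)
  show "{\<alpha> :: 'n \<Rightarrow> nat. mi_deg \<alpha> = k} \<subseteq> (\<Pi>\<^sub>E j\<in>UNIV. {..k})"
    by (auto simp: mi_deg_def PiE_def intro!: member_le_sum)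
  show "finite (\<Pi>\<^sub>E j\<in>(UNIV :: 'n set). {..k})"
    by (intro finite_PiE) auto
qed

definition partial_deriv :: "'n \<Rightarrow> (complex ^ 'n \<Rightarrow> complex) \<Rightarrow> complex ^ 'n \<Rightarrow> complex" where
  "partial_deriv j f z = deriv (\<lambda>w. f (z + axis j w)) 0"

text \<open>
  The index type carries no order, so the mixed derivative applies the partial
  derivatives along an arbitrary enumeration of it. For holomorphic functions they
  commute and the choice is immaterial.
\<close>

definition coords :: "'n::finite list" where
  "coords = (SOME js. distinct js \<and> set js = UNIV)"

definition mixed_deriv :: "('n::finite \<Rightarrow> nat) \<Rightarrow> (complex ^ 'n \<Rightarrow> complex) \<Rightarrow> complex ^ 'n \<Rightarrow> complex" where
  "mixed_deriv \<alpha> f = fold (\<lambda>j. partial_deriv j ^^ \<alpha> j) coords f"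

definition taylor_coeff :: "(complex ^ 'n \<Rightarrow> complex) \<Rightarrow> ('n \<Rightarrow> nat) \<Rightarrow> complex" where
  "taylor_coeff f \<alpha> = mixed_deriv \<alpha> f 0 / of_nat (mi_fact \<alpha>)"

text \<open>
  \<open>suminf\<close> is unspecified on divergent series, so the inequality for the sum over
  \<open>k \<ge> 1\<close> includes convergence explicitly.
\<close>

definition bohr_ineq :: "(complex ^ 'n \<Rightarrow> complex) \<Rightarrow> complex ^ 'n \<Rightarrow> bool" where
  "bohr_ineq f z \<longleftrightarrow>
     (let S = (\<lambda>k. \<Sum>\<alpha> | mi_deg \<alpha> = Suc k. norm (taylor_coeff f \<alpha> * mi_power z \<alpha>))
      in summable S \<and> (\<Sum>k. S k) \<le> 1)"

definition bohr_radius0 :: "'n::finite itself \<Rightarrow> real" where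
  "bohr_radius0 _ = (GREATEST \<rho>. \<forall>f :: complex ^ 'n \<Rightarrow> complex.
      f multi_holomorphic_on polydisk \<and> f 0 = 0 \<and> (\<forall>z\<in>polydisk. norm (f z) < 1) \<longrightarrow>
      (\<forall>z\<in>(\<lambda>w. \<rho> *\<^sub>R w) ` polydisk. bohr_ineq f z))"

end

theory Submission
  imports Defs
begin

text \<open>
  Call \<open>\<rho>\<close> admissible if the Bohr inequality holds on \<open>\<rho>\<close> times the polydisk for all functions
  in question. The polydisk being open, the admissible radii have a greatest element as soon as they
  are bounded (\<open>bohr_radius0_valid\<close>). So it remains to show that \<open>1 / sqrt (2 * n)\<close> is admissible
  and to bound all admissible radii.

  \<^bold>\<open>Lower bound.\<close> A holomorphic function bounded by 1 on the polydisk satisfies Bessel's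
  inequality: the squares of its Taylor coefficients have sum at most 1 (\<open>bessel_polydisk\<close>). By
  Cauchy-Schwarz it suffices that the squares of the nonconstant monomials have sum at most 1. If
  each coordinate has square modulus at most \<open>1 / (2 * n)\<close>, the sum over all monomials is at
  most \<open>(1 - 1 / (2 * n)) ^ (-n) \<le> 2\<close>, and the constant monomial accounts for 1.

  Bessel's inequality is obtained one variable at a time. The operator \<open>slice_coeff\<close> takes a
  coefficient in a single variable, and it preserves separately holomorphic functions bounded by 1,
  as a uniform limit of averages over roots of unity. The one-variable inequality, for families of
  functions (\<open>bessel_disc\<close>), follows from Parseval's identity for the discrete Fourier transform
  by the same averages. Mixed derivatives at the origin are iterated slice coefficients up to
  factorials (\<open>fold_partial_deriv_eq_iter_coeff\<close>).

  \<^bold>\<open>Upper bounds.\<close> A Blaschke product of degree 2 in one coordinate excludes all radii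
  above \<open>1 / sqrt 2\<close> (\<open>bohr_valid_imp_le_inverse_sqrt_2\<close>). For the logarithmic bound an explicit
  form replaces the usual random polynomials. Split \<open>d * N \<le> n\<close> of the variables into \<open>d\<close> blocks
  of \<open>N\<close> and alternate Fourier matrices with diagonal matrices of variables. The result is a form of
  degree \<open>d\<close> with \<open>N ^ d\<close> unimodular coefficients, bounded by \<open>N ^ ((d + 1) / 2)\<close> because the Fourier
  matrix is \<open>sqrt N\<close> times a unitary one. Hence \<open>\<rho> ^ (2 * d) * N ^ (d - 1) \<le> 1\<close> for admissible \<open>\<rho>\<close>
  (\<open>bohr_valid_imp_power_bound\<close>). With \<open>d\<close> the integer part of \<open>log n\<close> this gives
  \<open>\<rho> ^ 2 \<le> 4 * log n / n\<close> for \<open>n \<ge> 21\<close>, and for \<open>3 \<le> n \<le> 20\<close> the bound \<open>1 / sqrt 2\<close> is already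
  stronger.
\<close>

section \<open>The discrete Fourier transform\<close>

definition unit_root :: "nat \<Rightarrow> complex" where
  "unit_root N = cis (2 * pi / real N)"

lemma norm_unit_root [simp]: "norm (unit_root N) = 1"
  by (simp add: unit_root_def)

lemma unit_root_pow: "N > 0 \<Longrightarrow> unit_root N ^ N = 1"
  unfolding unit_root_def Complex.DeMoivre by simp

lemma unit_root_mult_cnj_pow [simp]: "unit_root N ^ k * cnj (unit_root N) ^ k = 1"
  by (metis complex_norm_square mult.commute norm_unit_root of_real_1 one_power2 power_mult_distrib power_one)

lemma unit_root_pow_inj:
  assumes "k < N" "l < N" "unit_root N ^ k = unit_root N ^ l"
  shows "k = l"
proof -
  have "inj_on (\<lambda>k. cis (2 * pi * real k / real N)) {..<N}"
    using Complex.bij_betw_roots_unity[of N] assms by (auto simp: bij_betw_def)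
  moreover have "unit_root N ^ k = cis (2 * pi * real k / real N)" for k
    unfolding unit_root_def Complex.DeMoivre by (simp add: mult_ac)
  ultimately show ?thesis
    using assms by (auto simp: inj_on_def)
qed

lemma unit_root_orthogonality:
  assumes "k < N" "l < N"
  shows "(\<Sum>m<N. unit_root N ^ (k * m) * cnj (unit_root N) ^ (l * m)) = (if k = l then of_nat N else 0)"
proof -
  let ?\<zeta> = "unit_root N ^ k * cnj (unit_root N) ^ l"
  have N: "N > 0" using assms by simp
  have *: "(\<Sum>m<N. unit_root N ^ (k * m) * cnj (unit_root N) ^ (l * m)) = (\<Sum>m<N. ?\<zeta> ^ m)"
    by (simp add: power_mult power_mult_distrib)
  show ?thesis
  proof (cases "k = l")
    case True
    then show ?thesis by (simp add: * )
  next
    case False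
    have "?\<zeta> \<noteq> 1"
    proof
      assume "?\<zeta> = 1"
      then have "unit_root N ^ k * (cnj (unit_root N) ^ l * unit_root N ^ l) = unit_root N ^ l"
        by (metis mult.assoc mult_1)
      then have "unit_root N ^ k = unit_root N ^ l"
        by (simp add: mult.commute)
      with unit_root_pow_inj assms False show False by blast
    qed
    moreover have "?\<zeta> ^ N = 1"
    proof -
      have "?\<zeta> ^ N = (unit_root N ^ N) ^ k * cnj (unit_root N ^ N) ^ l"
        by (simp add: power_mult_distrib flip: power_mult) (simp add: mult.commute)
      then show ?thesis using unit_root_pow[OF N] by simp
    qed
    ultimately show ?thesis
      using False by (simp add: * geometric_sum)
  qed
qed

text \<open>
  Up to the factor \<open>sqrt N\<close> the Fourier matrix is unitary. This serves twice: averaged over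
  the sample points of a circle it gives Bessel's inequality, and applied between
  successive blocks of variables it bounds the extremal form behind the upper bound.
\<close>

lemma dft_parseval:
  fixes x :: "nat \<Rightarrow> complex"
  shows "(\<Sum>k<N. (norm (\<Sum>m<N. x m * unit_root N ^ (k * m)))\<^sup>2) = real N * (\<Sum>m<N. (norm (x m))\<^sup>2)"
proof -
  have "complex_of_real (\<Sum>k<N. (norm (\<Sum>m<N. x m * unit_root N ^ (k * m)))\<^sup>2)
      = (\<Sum>k<N. \<Sum>m<N. \<Sum>l<N. x m * cnj (x l) * (unit_root N ^ (k * m) * cnj (unit_root N) ^ (k * l)))"
    by (simp only: of_real_sum complex_norm_square sum_product cnj_sum complex_cnj_mult complex_cnj_power mult_ac)
  also have "\<dots> = (\<Sum>m<N. \<Sum>l<N. x m * cnj (x l) * (\<Sum>k<N. unit_root N ^ (m * k) * cnj (unit_root N) ^ (l * k)))"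
  proof -
    have "(\<Sum>k<N. \<Sum>m<N. \<Sum>l<N. F k m l) = (\<Sum>m<N. \<Sum>l<N. \<Sum>k<N. F k m l)"
      for F :: "nat \<Rightarrow> nat \<Rightarrow> nat \<Rightarrow> complex"
      by (rule trans[OF sum.swap sum.cong[OF refl sum.swap]])
    from this[of "\<lambda>k m l. x m * cnj (x l) * (unit_root N ^ (k * m) * cnj (unit_root N) ^ (k * l))"]
    show ?thesis by (simp only: sum_distrib_left mult.commute)
  qed
  also have "\<dots> = (\<Sum>m<N. \<Sum>l<N. x m * cnj (x l) * (if m = l then of_nat N else 0))"
    by (intro sum.cong refl arg_cong2[where f="(*)"] unit_root_orthogonality) auto
  also have "\<dots> = (\<Sum>m<N. x m * cnj (x m) * of_nat N)"
    by (intro sum.cong refl) (simp add: if_distrib[of "(*) c" for c] sum.delta' cong: if_cong)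
  also have "\<dots> = complex_of_real (real N * (\<Sum>m<N. (norm (x m))\<^sup>2))"
    by (simp only: of_real_mult of_real_sum complex_norm_square sum_distrib_left of_real_of_nat_eq mult_ac)
  finally show ?thesis
    by (simp only: of_real_eq_iff)
qed

section \<open>Bessel's inequality on the disc\<close>

definition coeff1 :: "nat \<Rightarrow> (complex \<Rightarrow> complex) \<Rightarrow> complex" where
  "coeff1 k g = (deriv ^^ k) g 0 / fact k"

text \<open>
  Defined by iterated derivatives, \<open>coeff1 k g\<close> is the \<open>k\<close>-th Taylor coefficient
  of \<open>g\<close> at the origin; the next two lemmas pass between it and power series.
\<close>

lemma coeff1_sums:
  assumes "g holomorphic_on ball 0 1" "norm w < 1"
  shows "(\<lambda>k. coeff1 k g * w ^ k) sums g w"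
  using holomorphic_power_series[OF assms(1), of w] assms(2) by (simp add: coeff1_def)

lemma coeff1_unique:
  assumes "e > 0" "\<And>w. norm w < e \<Longrightarrow> (\<lambda>k. c k * w ^ k) sums g w"
  shows "coeff1 k g = c k"
proof -
  have "g has_fps_expansion Abs_fps c"
  proof (rule has_fps_expansionI)
    show "\<forall>\<^sub>F u in nhds 0. (\<lambda>n. fps_nth (Abs_fps c) n * u ^ n) sums g u"
      using assms by (intro eventually_nhds_in_open[THEN eventually_mono, of "ball 0 e"]) auto
  qed
  from fps_nth_fps_expansion[OF this, of k] show ?thesis by (simp add: coeff1_def)
qed

lemma coeff1_cong:
  assumes "\<And>w. norm w < 1 \<Longrightarrow> f w = g w"
  shows "coeff1 k f = coeff1 k g"
proof -
  have "eventually (\<lambda>w. f w = g w) (nhds 0)"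
    by (rule eventually_nhds_in_open[THEN eventually_mono, of "ball 0 1"]) (auto simp: assms)
  then have "(deriv ^^ k) f 0 = (deriv ^^ k) g 0"
    by (intro higher_deriv_cong_ev) auto
  then show ?thesis by (simp add: coeff1_def)
qed

text \<open>
  Cauchy's estimate on circles of radius \<open>s < 1\<close>, letting \<open>s\<close> tend to 1.
\<close>

lemma norm_coeff1_le_1:
  assumes hol: "g holomorphic_on ball 0 1" and bd: "\<And>w. norm w < 1 \<Longrightarrow> norm (g w) \<le> 1"
  shows "norm (coeff1 k g) \<le> 1"
proof -
  have le: "norm (coeff1 k g) * s ^ k \<le> 1" if s: "0 < s" "s < 1" for s
  proof -
    have "cball 0 s \<subseteq> (ball 0 1 :: complex set)" using s by auto
    then have "g holomorphic_on cball 0 s" using hol holomorphic_on_subset by blast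
    then have "norm ((deriv ^^ k) g 0) \<le> fact k * 1 / s ^ k"
      using s by (intro Cauchy_inequality)
        (auto intro: holomorphic_on_subset holomorphic_on_imp_continuous_on bd)
    then show ?thesis using s by (simp add: coeff1_def norm_divide field_simps)
  qed
  have "((\<lambda>s. norm (coeff1 k g) * s ^ k) \<longlongrightarrow> norm (coeff1 k g) * 1 ^ k) (at_left (1::real))"
    by (intro tendsto_intros)
  moreover have "\<forall>\<^sub>F s in at_left (1::real). norm (coeff1 k g) * s ^ k \<le> 1"
    unfolding eventually_at_left[of "0::real" 1, OF zero_less_one] using le by (intro exI[of _ 0]) auto
  ultimately have "norm (coeff1 k g) * 1 ^ k \<le> 1"
    by (rule tendsto_upperbound) simp
  then show ?thesis by simp
qed

text \<open>
  The \<open>M\<close>-point Riemann sum for the Cauchy integral of \<open>r ^ k\<close> times the \<open>k\<close>-th coefficient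
  over the circle of radius \<open>r\<close>. A finite sum in place of the integral depends
  holomorphically on parameters for free, and Parseval's identity for it is finite.
\<close>

definition circle_mean :: "nat \<Rightarrow> real \<Rightarrow> nat \<Rightarrow> (complex \<Rightarrow> complex) \<Rightarrow> complex" where
  "circle_mean M r k g =
     (\<Sum>m<M. g (of_real r * cnj (unit_root M) ^ m) * unit_root M ^ (k * m)) / of_nat M"

text \<open>
  Sampling at \<open>M\<close> points confuses the \<open>k\<close>-th frequency only with those congruent to \<open>k\<close>
  modulo \<open>M\<close>. All others below \<open>M\<close> cancel, and the remaining coefficients are at most 1.
  What matters is that the error does not depend on \<open>g\<close>.
\<close>

lemma circle_mean_aliasing:
  assumes hol: "g holomorphic_on ball 0 1" and bd: "\<And>w. norm w < 1 \<Longrightarrow> norm (g w) \<le> 1"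
    and r: "0 < r" "r < 1" and k: "k < M"
  shows "norm (circle_mean M r k g - coeff1 k g * of_real r ^ k) \<le> r ^ M / (1 - r)"
proof -
  \<comment> \<open>the factor by which the sampled mean weights the \<open>l\<close>-th term of the series\<close>
  define h where "h l = (\<Sum>m<M. cnj (unit_root M) ^ (l * m) * unit_root M ^ (k * m)) / of_nat M" for l
  define t where "t l = coeff1 l g * of_real r ^ l * (h l - (if l = k then 1 else 0))" for l
  have h_le: "norm (h l) \<le> 1" for l
  proof -
    have "norm (\<Sum>m<M. cnj (unit_root M) ^ (l * m) * unit_root M ^ (k * m)) \<le> (\<Sum>m<M. 1)"
      by (rule sum_norm_le) (simp add: norm_mult norm_power)
    then show ?thesis using k by (simp add: h_def norm_divide field_simps)
  qed
  have h_low: "h l = (if l = k then 1 else 0)" if "l < M" for l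
    using unit_root_orthogonality[OF k that] k by (auto simp: h_def mult.commute)
  have sm: "(\<lambda>l. coeff1 l g * (of_real r * cnj (unit_root M) ^ m) ^ l * unit_root M ^ (k * m)) sums
          (g (of_real r * cnj (unit_root M) ^ m) * unit_root M ^ (k * m))" for m
    using r by (intro sums_mult2 coeff1_sums hol) (simp add: norm_mult norm_power)
  have "(\<lambda>l. (\<Sum>m<M. coeff1 l g * (of_real r * cnj (unit_root M) ^ m) ^ l * unit_root M ^ (k * m)) / of_nat M)
      sums circle_mean M r k g"
    unfolding circle_mean_def by (intro sums_divide sums_sum sm)
  moreover have "(\<Sum>m<M. coeff1 l g * (of_real r * cnj (unit_root M) ^ m) ^ l * unit_root M ^ (k * m)) / of_nat M
      = coeff1 l g * of_real r ^ l * h l" for l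
    by (simp add: h_def sum_distrib_left power_mult_distrib mult_ac flip: power_mult)
  ultimately have "(\<lambda>l. coeff1 l g * of_real r ^ l * h l) sums circle_mean M r k g"
    by simp
  moreover have "(\<lambda>l. if l = k then coeff1 l g * of_real r ^ l else 0) sums (coeff1 k g * of_real r ^ k)"
    by (rule sums_single)
  ultimately have "(\<lambda>l. coeff1 l g * of_real r ^ l * h l - (if l = k then coeff1 l g * of_real r ^ l else 0))
      sums (circle_mean M r k g - coeff1 k g * of_real r ^ k)"
    by (rule sums_diff)
  moreover have "(\<lambda>l. coeff1 l g * of_real r ^ l * h l - (if l = k then coeff1 l g * of_real r ^ l else 0)) = t"
    by (auto simp: t_def algebra_simps fun_eq_iff)
  ultimately have t: "t sums (circle_mean M r k g - coeff1 k g * of_real r ^ k)"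
    by simp
  have "(\<Sum>l<M. t l) = 0"
    by (simp add: t_def h_low)
  with t have shift: "(\<lambda>l. t (l + M)) sums (circle_mean M r k g - coeff1 k g * of_real r ^ k)"
    by (simp add: sums_iff_shift)
  have "norm (t (l + M)) \<le> r ^ M * r ^ l" for l
  proof -
    have "norm (t (l + M)) = norm (coeff1 (l + M) g) * norm (h (l + M)) * (r ^ M * r ^ l)"
      using k r by (simp add: t_def norm_mult norm_power power_add)
    also have "\<dots> \<le> 1 * 1 * (r ^ M * r ^ l)"
      using r by (intro mult_mono mult_nonneg_nonneg norm_coeff1_le_1 hol bd h_le) auto
    finally show ?thesis by simp
  qed
  moreover have "(\<lambda>l. r ^ M * r ^ l) sums (r ^ M * (1 / (1 - r)))"
    using r by (intro sums_mult geometric_sums) auto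
  ultimately have "norm (\<Sum>l. t (l + M)) \<le> r ^ M * (1 / (1 - r))"
    using norm_suminf_le[of "\<lambda>l. t (l + M)" "\<lambda>l. r ^ M * r ^ l"] by (simp add: sums_iff)
  with shift show ?thesis by (simp add: sums_iff)
qed

lemma circle_mean_LIMSEQ:
  assumes "g holomorphic_on ball 0 1" "\<And>w. norm w < 1 \<Longrightarrow> norm (g w) \<le> 1" "0 < r" "r < 1"
  shows "(\<lambda>M. circle_mean M r k g) \<longlonglongrightarrow> coeff1 k g * of_real r ^ k"
proof (rule LIM_zero_cancel, rule Lim_null_comparison)
  show "\<forall>\<^sub>F M in sequentially. norm (circle_mean M r k g - coeff1 k g * of_real r ^ k) \<le> r ^ M / (1 - r)"
    using eventually_gt_at_top[of k]
    by eventually_elim (intro circle_mean_aliasing assms)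
  have "(\<lambda>M. r ^ M / (1 - r)) \<longlonglongrightarrow> 0 / (1 - r)"
    using assms by (intro tendsto_intros LIMSEQ_power_zero) auto
  then show "(\<lambda>M. r ^ M / (1 - r)) \<longlonglongrightarrow> 0" by simp
qed

text \<open>
  The finite family \<open>g\<close> is a vector-valued function with values in the Euclidean unit
  ball. The vector-valued form is what makes the passage to several variables an
  induction: the coefficients in the variables already treated form such a family in the
  next one.
\<close>

lemma bessel_disc:
  fixes g :: "'i \<Rightarrow> complex \<Rightarrow> complex"
  assumes fin: "finite I"
    and hol: "\<And>i. i \<in> I \<Longrightarrow> g i holomorphic_on ball 0 1"
    and bd: "\<And>w. norm w < 1 \<Longrightarrow> (\<Sum>i\<in>I. (norm (g i w))\<^sup>2) \<le> 1"
  shows "(\<Sum>i\<in>I. \<Sum>k<K. (norm (coeff1 k (g i)))\<^sup>2) \<le> 1"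
proof -
  have bd1: "norm (g i w) \<le> 1" if "i \<in> I" "norm w < 1" for i w
  proof -
    have "(norm (g i w))\<^sup>2 \<le> (\<Sum>i\<in>I. (norm (g i w))\<^sup>2)"
      using fin that by (intro member_le_sum) auto
    then have "(norm (g i w))\<^sup>2 \<le> 1" using bd[OF that(2)] by simp
    then show ?thesis by (simp add: power_le_one_iff abs_square_le_1)
  qed
  have mean: "(\<Sum>i\<in>I. \<Sum>k<K. (norm (circle_mean M r k (g i)))\<^sup>2) \<le> 1"
    if r: "0 < r" "r < 1" and M: "K \<le> M" "0 < M" for r M
  proof -
    have "(\<Sum>i\<in>I. \<Sum>k<K. (norm (circle_mean M r k (g i)))\<^sup>2)
        \<le> (\<Sum>i\<in>I. \<Sum>k<M. (norm (circle_mean M r k (g i)))\<^sup>2)"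
      using M by (intro sum_mono sum_mono2) auto
    also have "\<dots> = (\<Sum>i\<in>I. (\<Sum>k<M. (norm (\<Sum>m<M. g i (of_real r * cnj (unit_root M) ^ m) * unit_root M ^ (k * m)))\<^sup>2) / (real M)\<^sup>2)"
      by (simp only: circle_mean_def norm_divide power_divide norm_of_nat sum_divide_distrib[symmetric])
    also have "\<dots> = (\<Sum>i\<in>I. (\<Sum>m<M. (norm (g i (of_real r * cnj (unit_root M) ^ m)))\<^sup>2) / real M)"
      using M unfolding dft_parseval by (simp add: power2_eq_square)
    also have "\<dots> = (\<Sum>m<M. \<Sum>i\<in>I. (norm (g i (of_real r * cnj (unit_root M) ^ m)))\<^sup>2) / real M"
      unfolding sum_divide_distrib by (rule sum.swap)
    also have "\<dots> \<le> (\<Sum>m<M. 1) / real M"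
      using r by (intro divide_right_mono sum_mono bd) (auto simp: norm_mult norm_power)
    finally show ?thesis using M by simp
  qed
  have radius: "(\<Sum>i\<in>I. \<Sum>k<K. (norm (coeff1 k (g i) * of_real r ^ k))\<^sup>2) \<le> 1" if r: "0 < r" "r < 1" for r
  proof (rule tendsto_upperbound)
    show "(\<lambda>M. \<Sum>i\<in>I. \<Sum>k<K. (norm (circle_mean M r k (g i)))\<^sup>2)
        \<longlonglongrightarrow> (\<Sum>i\<in>I. \<Sum>k<K. (norm (coeff1 k (g i) * of_real r ^ k))\<^sup>2)"
      by (intro tendsto_intros circle_mean_LIMSEQ hol bd1 r)
    show "\<forall>\<^sub>F M in sequentially. (\<Sum>i\<in>I. \<Sum>k<K. (norm (circle_mean M r k (g i)))\<^sup>2) \<le> 1"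
      using eventually_ge_at_top[of "Suc K"] by eventually_elim (auto intro!: mean r)
  qed simp
  have "((\<lambda>r. \<Sum>i\<in>I. \<Sum>k<K. (norm (coeff1 k (g i) * of_real r ^ k))\<^sup>2)
      \<longlongrightarrow> (\<Sum>i\<in>I. \<Sum>k<K. (norm (coeff1 k (g i) * of_real 1 ^ k))\<^sup>2)) (at_left (1::real))"
    by (intro tendsto_intros)
  moreover have "\<forall>\<^sub>F r in at_left (1::real). (\<Sum>i\<in>I. \<Sum>k<K. (norm (coeff1 k (g i) * of_real r ^ k))\<^sup>2) \<le> 1"
    unfolding eventually_at_left[of "0::real" 1, OF zero_less_one] using radius by (intro exI[of _ 0]) auto
  ultimately have "(\<Sum>i\<in>I. \<Sum>k<K. (norm (coeff1 k (g i) * of_real 1 ^ k))\<^sup>2) \<le> 1"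
    by (rule tendsto_upperbound) simp
  then show ?thesis by simp
qed

section \<open>Bessel's inequality on the polydisk\<close>

definition vec_upd :: "complex ^ 'n \<Rightarrow> 'n \<Rightarrow> complex \<Rightarrow> complex ^ 'n" where
  "vec_upd z j w = (\<chi> i. if i = j then w else z $ i)"

lemma vec_upd_nth [simp]: "vec_upd z j w $ i = (if i = j then w else z $ i)"
  by (simp add: vec_upd_def)

lemma vec_upd_in_polydisk [simp]: "z \<in> polydisk \<Longrightarrow> norm w < 1 \<Longrightarrow> vec_upd z j w \<in> polydisk"
  by (simp add: polydisk_def)

lemma vec_upd_upd_same [simp]: "vec_upd (vec_upd z j u) j w = vec_upd z j w"
  by (simp add: vec_eq_iff)

lemma vec_upd_commute: "i \<noteq> j \<Longrightarrow> vec_upd (vec_upd z i u) j w = vec_upd (vec_upd z j w) i u"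
  by (auto simp: vec_eq_iff)

definition sep_holomorphic :: "(complex ^ 'n::finite \<Rightarrow> complex) \<Rightarrow> bool" where
  "sep_holomorphic F \<longleftrightarrow> (\<forall>z\<in>polydisk. \<forall>j. (\<lambda>w. F (vec_upd z j w)) holomorphic_on ball 0 1)"

lemma sep_holomorphicD:
  "sep_holomorphic F \<Longrightarrow> z \<in> polydisk \<Longrightarrow> (\<lambda>w. F (vec_upd z j w)) holomorphic_on ball 0 1"
  by (simp add: sep_holomorphic_def)

text \<open>
  Along a coordinate line the complex-linear derivative restricts to multiplication by
  its value on the basis vector.
\<close>

lemma multi_holomorphic_imp_sep_holomorphic:
  assumes f: "f multi_holomorphic_on polydisk"
  shows "sep_holomorphic f"
  unfolding sep_holomorphic_def
proof (intro ballI allI)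
  fix z :: "complex ^ 'a" and j
  assume z: "z \<in> polydisk"
  show "(\<lambda>w. f (vec_upd z j w)) holomorphic_on ball 0 1"
    unfolding holomorphic_on_def field_differentiable_def
  proof
    fix w :: complex assume w: "w \<in> ball 0 1"
    then have "vec_upd z j w \<in> polydisk" using z by simp
    then obtain L where L: "(f has_derivative L) (at (vec_upd z j w) within polydisk)"
      and lin: "Vector_Spaces.linear (*s) (*) L"
      using f unfolding multi_holomorphic_on_def by blast
    interpret Vector_Spaces.linear "(*s)" "(*)" L by (rule lin)
    have "bounded_linear (axis j :: complex \<Rightarrow> complex ^ 'a)"
      by (auto intro!: linearI simp: linear_linear vec_eq_iff axis_def simp flip: linear_conv_bounded_linear)
    then have "((\<lambda>w. vec_upd z j 0 + axis j w) has_derivative (\<lambda>h. 0 + axis j h)) (at w within ball 0 1)"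
      by (intro has_derivative_add has_derivative_const bounded_linear_imp_has_derivative)
    moreover have "vec_upd z j 0 + axis j w = vec_upd z j w" for w
      by (simp add: vec_eq_iff axis_def)
    ultimately have deriv_upd: "(vec_upd z j has_derivative (\<lambda>h. axis j h)) (at w within ball 0 1)"
      by simp
    have "vec_upd z j ` ball 0 1 \<subseteq> polydisk"
      using z by (intro image_subsetI vec_upd_in_polydisk) auto
    then have "(f has_derivative L) (at (vec_upd z j w) within vec_upd z j ` ball 0 1)"
      by (rule has_derivative_subset[OF L])
    note deriv_L = has_derivative_in_compose[OF deriv_upd this]
    have "L (axis j h) = L (axis j 1) * h" for h
    proof -
      have "axis j h = h *s axis j 1" by (simp add: vec_eq_iff axis_def)
      then show ?thesis by (simp only: scale mult.commute)
    qed
    then have L_eq: "(\<lambda>h. L (axis j h)) = (*) (L (axis j 1))" by (rule ext)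
    from deriv_L have "((\<lambda>w. f (vec_upd z j w)) has_field_derivative L (axis j 1)) (at w within ball 0 1)"
      unfolding has_field_derivative_def L_eq .
    then show "\<exists>f'. ((\<lambda>w. f (vec_upd z j w)) has_field_derivative f') (at w within ball 0 1)" ..
  qed
qed

text \<open>
  The \<open>k\<close>-th coefficient in the \<open>j\<close>-th variable, as a function of all variables; it is
  constant in the \<open>j\<close>-th one. For a function bounded by 1 it is again bounded by 1
  on the whole polydisk, unlike the partial derivatives, so it can be iterated.
\<close>

definition slice_coeff :: "'n \<Rightarrow> nat \<Rightarrow> (complex ^ 'n::finite \<Rightarrow> complex) \<Rightarrow> complex ^ 'n \<Rightarrow> complex" where
  "slice_coeff j k F z = coeff1 k (\<lambda>w. F (vec_upd z j w))"

text \<open>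
  In a variable \<open>i \<noteq> j\<close> the coefficient is the uniform limit of sampled circle means, each of
  which is a finite sum of holomorphic functions. This replaces differentiation under
  the Cauchy integral.
\<close>

lemma sep_holomorphic_slice_coeff:
  assumes F: "sep_holomorphic F" and bd: "\<And>z. z \<in> polydisk \<Longrightarrow> norm (F z) \<le> 1"
  shows "sep_holomorphic (slice_coeff j k F)"
  unfolding sep_holomorphic_def
proof (intro ballI allI)
  fix z :: "complex ^ 'a" and i
  assume z: "z \<in> polydisk"
  show "(\<lambda>w. slice_coeff j k F (vec_upd z i w)) holomorphic_on ball 0 1"
  proof (cases "i = j")
    case True
    then show ?thesis by (simp add: slice_coeff_def)
  next
    case False
    \<comment> \<open>circle means of radius 1/2, rescaled to approximate the coefficient itself\<close>
    define A where "A M w = circle_mean M (1/2) k (\<lambda>u. F (vec_upd (vec_upd z i w) j u)) * 2 ^ k" for M w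
    have hol: "A M holomorphic_on ball 0 1" for M
      unfolding A_def circle_mean_def vec_upd_commute[OF False]
      by (intro holomorphic_intros sep_holomorphicD F vec_upd_in_polydisk z)
        (auto simp: norm_mult norm_power)
    have err: "norm (A M w - slice_coeff j k F (vec_upd z i w)) \<le> 2 ^ Suc k * (1/2) ^ M"
      if w: "norm w < 1" and M: "k < M" for w M
    proof -
      let ?g = "\<lambda>u. F (vec_upd (vec_upd z i w) j u)"
      have "norm (circle_mean M (1/2) k ?g - coeff1 k ?g * of_real (1/2) ^ k) \<le> (1/2) ^ M / (1 - 1/2)"
        using w M z by (intro circle_mean_aliasing sep_holomorphicD F bd) auto
      moreover have "A M w - slice_coeff j k F (vec_upd z i w)
          = (circle_mean M (1/2) k ?g - coeff1 k ?g * of_real (1/2) ^ k) * 2 ^ k"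
        by (simp add: A_def slice_coeff_def field_simps power_divide)
      ultimately have "norm (A M w - slice_coeff j k F (vec_upd z i w)) \<le> (1/2) ^ M / (1 - 1/2) * norm ((2 :: complex) ^ k)"
        by (simp only: norm_mult) (intro mult_right_mono norm_ge_zero)
      then show ?thesis
        by (simp add: norm_power mult_ac)
    qed
    show ?thesis
    proof (rule holomorphic_uniform_sequence[of _ A])
      fix x :: complex assume x: "x \<in> ball 0 1"
      then obtain d where d: "d > 0" "cball x d \<subseteq> ball 0 1"
        using open_contains_cball open_ball by blast
      have "uniform_limit (cball x d) A (\<lambda>w. slice_coeff j k F (vec_upd z i w)) sequentially"
      proof (rule uniform_limitI)
        fix e :: real assume e: "e > 0"
        have "(\<lambda>M. 2 ^ Suc k * (1/2 :: real) ^ M) \<longlonglongrightarrow> 2 ^ Suc k * 0"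
          by (intro tendsto_intros LIMSEQ_power_zero) auto
        then have "\<forall>\<^sub>F M in sequentially. 2 ^ Suc k * (1/2 :: real) ^ M < e"
          using e by (intro order_tendstoD) auto
        then show "\<forall>\<^sub>F M in sequentially. \<forall>w\<in>cball x d. dist (A M w) (slice_coeff j k F (vec_upd z i w)) < e"
          using eventually_gt_at_top[of k]
        proof eventually_elim
          case (elim M)
          show ?case
          proof
            fix w assume "w \<in> cball x d"
            with d have "norm w < 1" by auto
            from err[OF this elim(2)] elim(1)
            show "dist (A M w) (slice_coeff j k F (vec_upd z i w)) < e"
              by (simp add: dist_norm)
          qed
        qed
      qed
      with d show "\<exists>d>0. cball x d \<subseteq> ball 0 1 \<and>
          uniform_limit (cball x d) A (\<lambda>w. slice_coeff j k F (vec_upd z i w)) sequentially" by blast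
    qed (use hol in auto)
  qed
qed

definition iter_coeff :: "'n list \<Rightarrow> ('n \<Rightarrow> nat) \<Rightarrow> (complex ^ 'n::finite \<Rightarrow> complex) \<Rightarrow> complex ^ 'n \<Rightarrow> complex" where
  "iter_coeff js \<alpha> = fold (\<lambda>j. slice_coeff j (\<alpha> j)) js"

lemma iter_coeff_Nil [simp]: "iter_coeff [] \<alpha> F = F"
  by (simp add: iter_coeff_def)

lemma iter_coeff_Cons [simp]: "iter_coeff (j # js) \<alpha> F = iter_coeff js \<alpha> (slice_coeff j (\<alpha> j) F)"
  by (simp add: iter_coeff_def)

lemma iter_coeff_cong: "(\<And>j. j \<in> set js \<Longrightarrow> \<alpha> j = \<beta> j) \<Longrightarrow> iter_coeff js \<alpha> F = iter_coeff js \<beta> F"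
  by (induction js arbitrary: F) auto

lemma iter_coeff_snoc [simp]: "iter_coeff (js @ [j]) \<alpha> F = slice_coeff j (\<alpha> j) (iter_coeff js \<alpha> F)"
  by (simp add: iter_coeff_def)

lemma norm_slice_coeff_le_1:
  assumes "sep_holomorphic F" "\<And>z. z \<in> polydisk \<Longrightarrow> norm (F z) \<le> 1" "z \<in> polydisk"
  shows "norm (slice_coeff j k F z) \<le> 1"
  unfolding slice_coeff_def using assms by (intro norm_coeff1_le_1 sep_holomorphicD) auto

lemma sep_holomorphic_iter_coeff:
  assumes "sep_holomorphic F" "\<And>z. z \<in> polydisk \<Longrightarrow> norm (F z) \<le> 1"
  shows "sep_holomorphic (iter_coeff js \<alpha> F)"
  using assms
proof (induction js arbitrary: F)
  case (Cons j js)
  then show ?case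
    by (simp add: sep_holomorphic_slice_coeff norm_slice_coeff_le_1)
qed simp

text \<open>
  Variables are treated one at a time. For the last variable \<open>j\<close>, the coefficients in the
  earlier variables, indexed by partial multi-indices, are a family to which the
  one-variable inequality applies, its hypothesis being the induction hypothesis at
  every point.
\<close>

lemma bessel_iter_coeff:
  fixes F :: "complex ^ 'n::finite \<Rightarrow> complex"
  assumes F: "sep_holomorphic F" "\<And>z. z \<in> polydisk \<Longrightarrow> norm (F z) \<le> 1"
    and "distinct js" and "z \<in> polydisk"
  shows "(\<Sum>\<alpha>\<in>PiE (set js) (\<lambda>_. {..<K}). (norm (iter_coeff js \<alpha> F z))\<^sup>2) \<le> 1"
  using assms(3,4)
proof (induction js arbitrary: z rule: rev_induct)
  case Nil
  then show ?case using F(2)[of z] by (simp add: power_le_one)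
next
  case (snoc j js)
  let ?P = "PiE (set js) (\<lambda>_. {..<K})"
  have fin: "finite ?P" by (intro finite_PiE) auto
  have j: "j \<notin> set js" using snoc.prems by simp
  have "(\<Sum>\<alpha>\<in>PiE (set (js @ [j])) (\<lambda>_. {..<K}). (norm (iter_coeff (js @ [j]) \<alpha> F z))\<^sup>2)
      = (\<Sum>(k, \<alpha>)\<in>{..<K} \<times> ?P. (norm (iter_coeff (js @ [j]) (\<alpha>(j := k)) F z))\<^sup>2)"
    using inj_combinator[OF j, of "\<lambda>_. {..<K}"]
    by (simp add: PiE_insert_eq sum.reindex case_prod_unfold)
  also have "\<dots> = (\<Sum>(k, \<alpha>)\<in>{..<K} \<times> ?P. (norm (slice_coeff j k (iter_coeff js \<alpha> F) z))\<^sup>2)"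
  proof (intro sum.cong refl, clarify)
    fix k \<alpha>
    have "iter_coeff js (\<alpha>(j := k)) F = iter_coeff js \<alpha> F"
      using j by (intro iter_coeff_cong) auto
    then show "(norm (iter_coeff (js @ [j]) (\<alpha>(j := k)) F z))\<^sup>2 = (norm (slice_coeff j k (iter_coeff js \<alpha> F) z))\<^sup>2"
      by simp
  qed
  also have "\<dots> = (\<Sum>\<alpha>\<in>?P. \<Sum>k<K. (norm (slice_coeff j k (iter_coeff js \<alpha> F) z))\<^sup>2)"
    by (subst sum.swap) (simp add: sum.cartesian_product)
  also have "\<dots> \<le> 1"
    unfolding slice_coeff_def
  proof (rule bessel_disc[OF fin])
    show "(\<lambda>w. iter_coeff js \<alpha> F (vec_upd z j w)) holomorphic_on ball 0 1" for \<alpha>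
      using snoc.prems by (intro sep_holomorphicD sep_holomorphic_iter_coeff F)
    show "(\<Sum>\<alpha>\<in>?P. (norm (iter_coeff js \<alpha> F (vec_upd z j w)))\<^sup>2) \<le> 1" if "norm w < 1" for w
      using snoc.prems that by (intro snoc.IH) auto
  qed
  finally show ?case .
qed

text \<open>
  Iterated partial derivatives in one variable see only the restriction to a line, so
  the identity holds for arbitrary \<open>F\<close>.
\<close>

lemma higher_partial_deriv:
  "(partial_deriv j ^^ k) F (z + axis j w) = (deriv ^^ k) (\<lambda>u. F (z + axis j u)) w"
proof (induction k arbitrary: w)
  case (Suc k)
  let ?h = "\<lambda>u. (partial_deriv j ^^ k) F (z + axis j u)"
  have axis_add: "axis j (u + w) = axis j u + axis j w" for u :: complex
    by (simp add: vec_eq_iff axis_def)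
  have "(partial_deriv j ^^ Suc k) F (z + axis j w) = deriv (\<lambda>u. ?h (u + w)) 0"
    by (simp add: partial_deriv_def axis_add add_ac)
  also have "\<dots> = deriv ?h w"
    by (simp only: deriv_def DERIV_shift[of ?h _ 0 w, symmetric] add_0)
  also have "?h = (deriv ^^ k) (\<lambda>u. F (z + axis j u))"
    using Suc.IH by blast
  finally show ?case by simp
qed simp

lemma coeff1_cmult:
  assumes "g holomorphic_on ball 0 1"
  shows "coeff1 k (\<lambda>w. c * g w) = c * coeff1 k g"
  using higher_deriv_cmult[OF assms, of 0 k c] by (simp add: coeff1_def)

text \<open>
  Each differentiation moves one variable into \<open>Z\<close>, the variables already treated, and the
  result is compared with an iterated coefficient only where these vanish. The function \<open>F\<close>
  stands for the derivative so far, \<open>G\<close> for the coefficient so far and \<open>c\<close> for the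
  accumulated factorials.
\<close>

lemma fold_partial_deriv_eq_iter_coeff:
  fixes F G :: "complex ^ 'n::finite \<Rightarrow> complex"
  assumes "distinct js" "set js \<inter> Z = {}"
    and "\<And>z. z \<in> polydisk \<Longrightarrow> (\<And>i. i \<in> Z \<Longrightarrow> (z :: complex ^ 'n) $ i = 0) \<Longrightarrow> F z = c * G z"
    and "sep_holomorphic G"
    and "\<And>z. z \<in> polydisk \<Longrightarrow> norm (G z) \<le> 1"
    and "z \<in> polydisk" "\<And>i. i \<in> Z \<union> set js \<Longrightarrow> (z :: complex ^ 'n) $ i = 0"
  shows "fold (\<lambda>j. partial_deriv j ^^ \<alpha> j) js F z = c * (\<Prod>j\<in>set js. fact (\<alpha> j)) * iter_coeff js \<alpha> G z"
  using assms
proof (induction js arbitrary: Z F G c)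
  case Nil
  then show ?case by simp
next
  case (Cons j js)
  let ?k = "\<alpha> j"
  have step: "(partial_deriv j ^^ ?k) F y = (c * fact ?k) * slice_coeff j ?k G y"
    if y: "y \<in> polydisk" "\<And>i. i \<in> insert j Z \<Longrightarrow> y $ i = 0" for y
  proof -
    have upd: "y + axis j u = vec_upd y j u" for u
      using y(2) by (auto simp: vec_eq_iff axis_def)
    have "(partial_deriv j ^^ ?k) F y = fact ?k * coeff1 ?k (\<lambda>u. F (y + axis j u))"
      using higher_partial_deriv[where j = j and k = ?k and F = F and z = y and w = 0] by (simp add: coeff1_def axis_eq_0_iff[THEN iffD2])
    also have "coeff1 ?k (\<lambda>u. F (y + axis j u)) = coeff1 ?k (\<lambda>u. c * G (vec_upd y j u))"
    proof (rule coeff1_cong)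
      fix u :: complex assume "norm u < 1"
      then show "F (y + axis j u) = c * G (vec_upd y j u)"
        unfolding upd using y Cons.prems(2) by (intro Cons.prems(3)) auto
    qed
    also have "\<dots> = c * slice_coeff j ?k G y"
      unfolding slice_coeff_def using Cons.prems(4) y(1) by (intro coeff1_cmult sep_holomorphicD)
    finally show ?thesis by simp
  qed
  have "fold (\<lambda>j. partial_deriv j ^^ \<alpha> j) js ((partial_deriv j ^^ ?k) F) z
      = (c * fact ?k) * (\<Prod>j\<in>set js. fact (\<alpha> j)) * iter_coeff js \<alpha> (slice_coeff j ?k G) z"
  proof (rule Cons.IH[of "insert j Z"])
    show "sep_holomorphic (slice_coeff j ?k G)"
      using Cons.prems by (intro sep_holomorphic_slice_coeff)
    show "norm (slice_coeff j ?k G z) \<le> 1" if "z \<in> polydisk" for z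
      using Cons.prems that by (intro norm_slice_coeff_le_1)
  qed (use Cons.prems step in auto)
  then show ?case
    using Cons.prems(1) by (simp add: mult_ac)
qed

lemma coords: "distinct (coords :: 'n::finite list)" "set (coords :: 'n list) = UNIV"
proof -
  obtain xs :: "'n list" where "set xs = UNIV \<and> distinct xs"
    using finite_distinct_list[of "UNIV :: 'n set"] by auto
  then have "distinct (coords :: 'n::finite list) \<and> set (coords :: 'n list) = UNIV"
    unfolding coords_def by (intro someI_ex[of "\<lambda>js. distinct js \<and> set js = UNIV"]) auto
  then show "distinct (coords :: 'n::finite list)" "set (coords :: 'n list) = UNIV" by auto
qed

lemma taylor_coeff_eq_iter_coeff:
  fixes f :: "complex ^ 'n::finite \<Rightarrow> complex"
  assumes "sep_holomorphic f" "\<And>z. z \<in> polydisk \<Longrightarrow> norm (f z) \<le> 1"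
  shows "taylor_coeff f \<alpha> = iter_coeff coords \<alpha> f 0"
proof -
  have "mixed_deriv \<alpha> f 0 = 1 * (\<Prod>j\<in>set coords. fact (\<alpha> j)) * iter_coeff coords \<alpha> f 0"
    unfolding mixed_deriv_def
    by (rule fold_partial_deriv_eq_iter_coeff[where Z = "{}"])
      (use assms in \<open>auto simp: coords polydisk_def\<close>)
  then show ?thesis
    by (simp add: taylor_coeff_def mi_fact_def coords)
qed

lemma bessel_polydisk:
  fixes f :: "complex ^ 'n::finite \<Rightarrow> complex"
  assumes "sep_holomorphic f" "\<And>z. z \<in> polydisk \<Longrightarrow> norm (f z) \<le> 1"
  shows "(\<Sum>\<alpha>\<in>PiE UNIV (\<lambda>_. {..<K}). (norm (taylor_coeff f \<alpha>))\<^sup>2) \<le> 1"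
proof -
  have "taylor_coeff f \<alpha> = iter_coeff coords \<alpha> f 0" for \<alpha>
    by (rule taylor_coeff_eq_iter_coeff[OF assms])
  moreover have "(0 :: complex ^ 'n) \<in> polydisk" by (simp add: polydisk_def)
  ultimately show ?thesis
    using bessel_iter_coeff[OF assms coords(1), of 0 K] by (simp add: coords)
qed

section \<open>The lower bound\<close>

text \<open>
  The Bohr radius is the greatest \<open>\<rho>\<close> with this property; such \<open>\<rho>\<close> are called admissible.
\<close>

definition bohr_valid :: "'n::finite itself \<Rightarrow> real \<Rightarrow> bool" where
  "bohr_valid _ \<rho> \<longleftrightarrow> (\<forall>f :: complex ^ 'n \<Rightarrow> complex.
      f multi_holomorphic_on polydisk \<and> f 0 = 0 \<and> (\<forall>z\<in>polydisk. norm (f z) < 1) \<longrightarrow>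
      (\<forall>z\<in>(\<lambda>w. \<rho> *\<^sub>R w) ` polydisk. bohr_ineq f z))"

lemma bohr_validD:
  fixes f :: "complex ^ 'n::finite \<Rightarrow> complex"
  assumes "bohr_valid TYPE('n) \<rho>" "f multi_holomorphic_on polydisk" "f 0 = 0"
    "\<And>z. z \<in> polydisk \<Longrightarrow> norm (f z) < 1" "z \<in> polydisk"
  shows "bohr_ineq f (\<rho> *\<^sub>R z)"
  using assms unfolding bohr_valid_def by blast

lemma scaleR_in_polydisk:
  fixes z :: "complex ^ 'n::finite"
  assumes "z \<in> polydisk" "\<bar>t\<bar> \<le> 1"
  shows "t *\<^sub>R z \<in> polydisk"
  unfolding polydisk_def
proof (intro CollectI allI)
  fix j
  have "norm ((t *\<^sub>R z) $ j) = \<bar>t\<bar> * norm (z $ j)" by simp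
  also have "\<dots> \<le> norm (z $ j)" using assms by (simp add: mult_left_le_one_le)
  also have "\<dots> < 1" using assms by (simp add: polydisk_def)
  finally show "norm ((t *\<^sub>R z) $ j) < 1" .
qed

text \<open>
  The polydisk is open and balanced: every point has room to be scaled outwards. This is
  why the supremum of the admissible radii is itself admissible.
\<close>

lemma polydisk_shrink:
  fixes z :: "complex ^ 'n::finite"
  assumes "z \<in> polydisk"
  obtains t w where "0 < t" "t < 1" "w \<in> polydisk" "z = t *\<^sub>R w"
proof -
  define m where "m = Max (range (\<lambda>j. norm (z $ j)))"
  have m: "norm (z $ j) \<le> m" for j
    unfolding m_def by (intro Max_ge) auto
  have "m < 1"
    unfolding m_def using assms by (subst Max_less_iff) (auto simp: polydisk_def)
  moreover have "0 \<le> m" using m[of undefined] norm_ge_zero order_trans by blast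
  ultimately obtain t where t: "m < t" "0 < t" "t < 1" using dense by (metis le_less_trans)
  have "(1 / t) *\<^sub>R z \<in> polydisk"
    using t m by (auto simp: polydisk_def intro: le_less_trans)
  moreover have "z = t *\<^sub>R (1 / t) *\<^sub>R z" using t by simp
  ultimately show ?thesis using that t by blast
qed

text \<open>
  A greatest admissible radius exists once the admissible radii are bounded above: a
  point of \<open>b\<close> times the polydisk, \<open>b\<close> the supremum, already lies in \<open>\<rho>\<close> times the polydisk
  for some admissible \<open>\<rho>\<close>.
\<close>

lemma bohr_radius0_valid:
  assumes "bohr_valid TYPE('n::finite) L" "L > 0" and bd: "\<And>\<rho>. bohr_valid TYPE('n) \<rho> \<Longrightarrow> \<rho> \<le> U"
  shows "bohr_valid TYPE('n) (bohr_radius0 TYPE('n))" "L \<le> bohr_radius0 TYPE('n)"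
proof -
  define b where "b = Sup {\<rho>. bohr_valid TYPE('n) \<rho>}"
  have bdd: "bdd_above {\<rho>. bohr_valid TYPE('n) \<rho>}"
    using bd by (intro bdd_aboveI[of _ U]) auto
  have le: "\<rho> \<le> b" if "bohr_valid TYPE('n) \<rho>" for \<rho>
    unfolding b_def using that bdd by (intro cSup_upper) auto
  have "L \<le> b" by (intro le assms)
  with assms have b: "0 < b" by simp
  have valid: "bohr_valid TYPE('n) b"
    unfolding bohr_valid_def
  proof (intro allI impI ballI, elim conjE imageE)
    fix f :: "complex ^ 'n \<Rightarrow> complex" and y z :: "complex ^ 'n"
    assume f: "f multi_holomorphic_on polydisk" "f 0 = 0" "\<forall>z\<in>polydisk. norm (f z) < 1"
      and y: "y = b *\<^sub>R z" "z \<in> polydisk"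
    obtain t w where t: "0 < t" "t < 1" "w \<in> polydisk" "z = t *\<^sub>R w"
      using polydisk_shrink[OF y(2)] by blast
    have "t * b < b" using t b by simp
    then obtain \<rho> where \<rho>: "bohr_valid TYPE('n) \<rho>" "t * b < \<rho>"
      unfolding b_def using less_cSup_iff[OF _ bdd] assms(1) by auto
    then have "0 < \<rho>" using t b by (meson less_trans mult_pos_pos)
    have "bohr_ineq f (\<rho> *\<^sub>R (t * b / \<rho>) *\<^sub>R w)"
      using \<rho> f t b \<open>0 < \<rho>\<close> by (intro bohr_validD scaleR_in_polydisk) auto
    moreover have "\<rho> *\<^sub>R (t * b / \<rho>) *\<^sub>R w = y"
      using \<open>0 < \<rho>\<close> by (simp add: y t mult.commute)
    ultimately show "bohr_ineq f y" by simp
  qed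
  have "bohr_radius0 TYPE('n) = (GREATEST \<rho>. bohr_valid TYPE('n) \<rho>)"
    by (simp add: bohr_radius0_def bohr_valid_def)
  also have "\<dots> = b"
    using valid le by (rule Greatest_equality)
  finally have eq: "bohr_radius0 TYPE('n) = b" .
  show "bohr_valid TYPE('n) (bohr_radius0 TYPE('n))" using valid eq by simp
  show "L \<le> bohr_radius0 TYPE('n)" using \<open>L \<le> b\<close> eq by simp
qed

text \<open>
  The sum is a product of geometric sums, hence at most \<open>(1 - 1/(2n)) ^ (-n)\<close>, which
  Bernoulli's inequality bounds by 2. This is where the constant of the lower bound comes
  from: with the constant term 1 removed, 1 is left.
\<close>

lemma sum_monomials_le_2:
  fixes x :: "'n::finite \<Rightarrow> real"
  assumes "\<And>j. 0 \<le> x j" "\<And>j. x j \<le> 1 / (2 * real CARD('n))"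
  shows "(\<Sum>\<alpha>\<in>PiE UNIV (\<lambda>_. {..<K}). \<Prod>j\<in>UNIV. x j ^ \<alpha> j) \<le> 2"
proof -
  define n where "n = CARD('n)"
  have n: "n \<ge> 1" by (simp add: n_def Suc_leI)
  define q where "q = 1 / (2 * real n)"
  have q: "0 < q" "q \<le> 1/2" using n by (auto simp: q_def field_simps)
  have "(\<Sum>\<alpha>\<in>PiE UNIV (\<lambda>_. {..<K}). \<Prod>j\<in>UNIV. x j ^ \<alpha> j) = (\<Prod>j\<in>UNIV. \<Sum>k<K. x j ^ k)"
    by (rule prod_sum_PiE[symmetric]) auto
  also have "\<dots> \<le> (\<Prod>j\<in>(UNIV :: 'n set). 1 / (1 - q))"
  proof (intro prod_mono conjI sum_nonneg)
    fix j
    have xq: "x j \<le> q" using assms(2)[of j] by (simp add: q_def n_def)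
    have "(\<Sum>k<K. x j ^ k) = (1 - x j ^ K) / (1 - x j)"
      using xq q by (subst sum_gp_strict) auto
    also have "\<dots> \<le> 1 / (1 - q)"
      using xq q assms(1)[of j] by (intro frac_le) auto
    finally show "(\<Sum>k<K. x j ^ k) \<le> 1 / (1 - q)" .
  qed (use assms in auto)
  also have "\<dots> = 1 / (1 - q) ^ n" by (simp add: n_def power_one_over)
  also have "\<dots> \<le> 1 / (1/2)"
  proof (intro divide_left_mono)
    have "1 + real n * (-q) \<le> (1 + (-q)) ^ n" using q by (intro Bernoulli_inequality) auto
    then show "1/2 \<le> (1 - q) ^ n" using n by (simp add: q_def)
  qed (use q in auto)
  finally show ?thesis by simp
qed

text \<open>
  By the Cauchy-Schwarz inequality, a partial Bohr sum is at most the product of the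
  Euclidean norm of the coefficients, which Bessel's inequality bounds by 1, and that of
  the nonconstant monomials at the point.
\<close>

lemma bohr_valid_lower:
  "bohr_valid TYPE('n::finite) (1 / sqrt (2 * real CARD('n)))"
  unfolding bohr_valid_def
proof (intro allI impI ballI, elim conjE imageE)
  fix f :: "complex ^ 'n \<Rightarrow> complex" and y w :: "complex ^ 'n"
  assume f: "f multi_holomorphic_on polydisk" "f 0 = 0" "\<forall>z\<in>polydisk. norm (f z) < 1"
    and y: "y = (1 / sqrt (2 * real CARD('n))) *\<^sub>R w" "w \<in> polydisk"
  let ?c = "\<lambda>\<alpha>. norm (taylor_coeff f \<alpha>)" and ?m = "\<lambda>\<alpha>. norm (mi_power y \<alpha>)"
  have sep: "sep_holomorphic f" by (rule multi_holomorphic_imp_sep_holomorphic[OF f(1)])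
  have y_le: "(norm (y $ j))\<^sup>2 \<le> 1 / (2 * real CARD('n))" for j
  proof -
    have "(norm (w $ j))\<^sup>2 \<le> 1" using y(2) by (simp add: polydisk_def power_le_one less_imp_le)
    then show ?thesis by (simp add: y(1) power_mult_distrib power_divide divide_right_mono)
  qed
  have box: "(\<Sum>\<alpha>\<in>PiE UNIV (\<lambda>_. {..<Suc m}) - {\<lambda>_. 0}. ?c \<alpha> * ?m \<alpha>) \<le> 1" for m
  proof -
    let ?B = "PiE (UNIV :: 'n set) (\<lambda>_. {..<Suc m})"
    have fin: "finite ?B" by (intro finite_PiE) auto
    have "(\<Sum>\<alpha>\<in>?B. (?m \<alpha>)\<^sup>2) = (\<Sum>\<alpha>\<in>?B. \<Prod>j\<in>UNIV. ((norm (y $ j))\<^sup>2) ^ \<alpha> j)"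
      by (simp add: mi_power_def prod_norm[symmetric] norm_power prod_power_distrib mult.commute flip: power_mult)
    also have "\<dots> \<le> 2" by (intro sum_monomials_le_2 y_le) auto
    finally have "(\<Sum>\<alpha>\<in>?B - {\<lambda>_. 0}. (?m \<alpha>)\<^sup>2) \<le> 1"
      using fin by (subst sum_diff) (auto simp: mi_power_def)
    moreover have "(\<Sum>\<alpha>\<in>?B - {\<lambda>_. 0}. (?c \<alpha>)\<^sup>2) \<le> 1"
    proof -
      have "(\<Sum>\<alpha>\<in>?B - {\<lambda>_. 0}. (?c \<alpha>)\<^sup>2) \<le> (\<Sum>\<alpha>\<in>?B. (?c \<alpha>)\<^sup>2)"
        using fin by (intro sum_mono2) auto
      also have "\<dots> \<le> 1" using f(3) by (intro bessel_polydisk sep) (auto intro: less_imp_le)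
      finally show ?thesis .
    qed
    ultimately have "(\<Sum>\<alpha>\<in>?B - {\<lambda>_. 0}. (?c \<alpha>)\<^sup>2) * (\<Sum>\<alpha>\<in>?B - {\<lambda>_. 0}. (?m \<alpha>)\<^sup>2) \<le> 1"
      by (intro mult_le_one sum_nonneg) auto
    with Cauchy_Schwarz_ineq_sum[of ?c ?m "?B - {\<lambda>_. 0}"]
    have "(\<Sum>\<alpha>\<in>?B - {\<lambda>_. 0}. ?c \<alpha> * ?m \<alpha>)\<^sup>2 \<le> 1" by linarith
    then show ?thesis by (simp add: abs_square_le_1 abs_le_iff)
  qed
  let ?S = "\<lambda>k. \<Sum>\<alpha> | mi_deg \<alpha> = Suc k. norm (taylor_coeff f \<alpha> * mi_power y \<alpha>)"
  have partial: "(\<Sum>k<m. ?S k) \<le> 1" for m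
  proof -
    have "(\<Sum>k<m. ?S k) = (\<Sum>\<alpha>\<in>(\<Union>k<m. {\<alpha>. mi_deg \<alpha> = Suc k}). norm (taylor_coeff f \<alpha> * mi_power y \<alpha>))"
      by (rule sum.UNION_disjoint[symmetric]) (auto simp: finite_mi_deg_eq)
    also have "\<dots> \<le> (\<Sum>\<alpha>\<in>PiE UNIV (\<lambda>_. {..<Suc m}) - {\<lambda>_. 0}. norm (taylor_coeff f \<alpha> * mi_power y \<alpha>))"
    proof (rule sum_mono2)
      show "(\<Union>k<m. {\<alpha> :: 'n \<Rightarrow> nat. mi_deg \<alpha> = Suc k}) \<subseteq> PiE UNIV (\<lambda>_. {..<Suc m}) - {\<lambda>_. 0}"
      proof
        fix \<alpha> :: "'n \<Rightarrow> nat" assume "\<alpha> \<in> (\<Union>k<m. {\<alpha>. mi_deg \<alpha> = Suc k})"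
        then obtain k where k: "k < m" "mi_deg \<alpha> = Suc k" by auto
        have "\<alpha> j \<le> mi_deg \<alpha>" for j unfolding mi_deg_def by (intro member_le_sum) auto
        then have "\<alpha> j < Suc m" for j using k by (metis Suc_le_eq le_trans less_Suc_eq_le)
        moreover have "\<alpha> \<noteq> (\<lambda>_. 0)" using k by (auto simp: mi_deg_def)
        ultimately show "\<alpha> \<in> PiE UNIV (\<lambda>_. {..<Suc m}) - {\<lambda>_. 0}" by auto
      qed
    qed (auto intro!: finite_Diff finite_PiE)
    also have "\<dots> \<le> 1" using box[of m] by (simp add: norm_mult)
    finally show ?thesis .
  qed
  have "summable ?S"
    using partial by (intro summableI_nonneg_bounded[of _ 1] sum_nonneg) auto
  moreover have "(\<Sum>k. ?S k) \<le> 1"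
    using calculation partial by (rule suminf_le_const)
  ultimately show "bohr_ineq f y" by (simp add: bohr_ineq_def)
qed

section \<open>Holomorphic functions of several variables\<close>

lemma complex_linearI:
  fixes L :: "complex ^ 'n::finite \<Rightarrow> complex"
  assumes "\<And>x y. L (x + y) = L x + L y" "\<And>c x. L (c *s x) = c * L x"
  shows "Vector_Spaces.linear (*s) (*) L"
  unfolding Vector_Spaces.linear_iff
  using assms vec.vector_space_axioms vector_space_over_itself.vector_space_axioms by auto

lemma complex_linearD:
  fixes L :: "complex ^ 'n::finite \<Rightarrow> complex"
  assumes "Vector_Spaces.linear (*s) (*) L"
  shows "L (x + y) = L x + L y" "L (c *s x) = c * L x"
  using assms unfolding Vector_Spaces.linear_iff by auto

lemma multi_holomorphic_const: "(\<lambda>_. c) multi_holomorphic_on U"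
  unfolding multi_holomorphic_on_def
  by (intro ballI exI[of _ "\<lambda>_. 0"]) (auto intro: complex_linearI)

lemma multi_holomorphic_compose_nth:
  assumes "\<phi> holomorphic_on ball 0 1"
  shows "(\<lambda>z :: complex ^ 'n::finite. \<phi> (z $ i)) multi_holomorphic_on polydisk"
  unfolding multi_holomorphic_on_def
proof
  fix z :: "complex ^ 'n" assume z: "z \<in> polydisk"
  then have "z $ i \<in> ball 0 1" by (simp add: polydisk_def)
  then have "(\<phi> has_field_derivative deriv \<phi> (z $ i)) (at (z $ i))"
    using assms by (intro holomorphic_derivI[of _ "ball 0 1"]) auto
  then have "(\<phi> has_derivative (*) (deriv \<phi> (z $ i))) (at (z $ i))"
    by (simp add: has_field_derivative_def)
  moreover have "((\<lambda>z. z $ i) has_derivative (\<lambda>h. h $ i)) (at z within polydisk)"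
    by (intro bounded_linear_imp_has_derivative bounded_linear_vec_nth)
  ultimately have "((\<lambda>z. \<phi> (z $ i)) has_derivative (\<lambda>h. deriv \<phi> (z $ i) * h $ i)) (at z within polydisk)"
    by (rule has_derivative_compose[rotated])
  moreover have "Vector_Spaces.linear (*s) (*) (\<lambda>h :: complex ^ 'n. deriv \<phi> (z $ i) * h $ i)"
    by (intro complex_linearI) (auto simp: algebra_simps)
  ultimately show "\<exists>L. ((\<lambda>z. \<phi> (z $ i)) has_derivative L) (at z within polydisk) \<and> Vector_Spaces.linear (*s) (*) L"
    by blast
qed

lemma multi_holomorphic_nth: "(\<lambda>z :: complex ^ 'n::finite. z $ i) multi_holomorphic_on polydisk"
  using multi_holomorphic_compose_nth[of "\<lambda>w. w"] by simp

lemma multi_holomorphic_add: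
  assumes "f multi_holomorphic_on U" "g multi_holomorphic_on U"
  shows "(\<lambda>z. f z + g z) multi_holomorphic_on U"
  unfolding multi_holomorphic_on_def
proof
  fix z assume "z \<in> U"
  with assms obtain L M where *: "(f has_derivative L) (at z within U)" "Vector_Spaces.linear (*s) (*) L"
    "(g has_derivative M) (at z within U)" "Vector_Spaces.linear (*s) (*) M"
    unfolding multi_holomorphic_on_def by meson
  show "\<exists>L. ((\<lambda>z. f z + g z) has_derivative L) (at z within U) \<and> Vector_Spaces.linear (*s) (*) L"
    using * by (intro exI[of _ "\<lambda>h. L h + M h"] conjI has_derivative_add complex_linearI)
      (auto simp: complex_linearD algebra_simps)
qed

lemma multi_holomorphic_mult:
  assumes "f multi_holomorphic_on U" "g multi_holomorphic_on U"
  shows "(\<lambda>z. f z * g z) multi_holomorphic_on U"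
  unfolding multi_holomorphic_on_def
proof
  fix z assume "z \<in> U"
  with assms obtain L M where *: "(f has_derivative L) (at z within U)" "Vector_Spaces.linear (*s) (*) L"
    "(g has_derivative M) (at z within U)" "Vector_Spaces.linear (*s) (*) M"
    unfolding multi_holomorphic_on_def by meson
  show "\<exists>L. ((\<lambda>z. f z * g z) has_derivative L) (at z within U) \<and> Vector_Spaces.linear (*s) (*) L"
    using * by (intro exI[of _ "\<lambda>h. f z * M h + L h * g z"] conjI has_derivative_mult complex_linearI)
      (auto simp: complex_linearD algebra_simps)
qed

lemma multi_holomorphic_sum:
  "(\<And>i. i \<in> I \<Longrightarrow> f i multi_holomorphic_on U) \<Longrightarrow> (\<lambda>z. \<Sum>i\<in>I. f i z) multi_holomorphic_on U"
  by (induction I rule: infinite_finite_induct)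
    (auto intro: multi_holomorphic_add multi_holomorphic_const)

section \<open>The upper bound from one variable\<close>

text \<open>
  To exclude a radius it suffices to know finitely many coefficients of a test function.
\<close>

lemma bohr_ineq_finite_sum:
  assumes "bohr_ineq f y" "finite A" "\<And>\<alpha>. \<alpha> \<in> A \<Longrightarrow> mi_deg \<alpha> \<noteq> 0"
  shows "(\<Sum>\<alpha>\<in>A. norm (taylor_coeff f \<alpha> * mi_power y \<alpha>)) \<le> 1"
proof -
  let ?t = "\<lambda>\<alpha>. norm (taylor_coeff f \<alpha> * mi_power y \<alpha>)"
  let ?S = "\<lambda>k. \<Sum>\<alpha> | mi_deg \<alpha> = Suc k. ?t \<alpha>"
  have S: "summable ?S" "suminf ?S \<le> 1"
    using assms(1) by (simp_all add: bohr_ineq_def Let_def)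
  obtain m where m: "\<And>\<alpha>. \<alpha> \<in> A \<Longrightarrow> mi_deg \<alpha> \<le> m"
    using finite_nat_set_iff_bounded_le[of "mi_deg ` A"] assms(2) by auto
  have "(\<Sum>\<alpha>\<in>A. ?t \<alpha>) \<le> (\<Sum>\<alpha>\<in>(\<Union>k<m. {\<alpha>. mi_deg \<alpha> = Suc k}). ?t \<alpha>)"
  proof (rule sum_mono2)
    show "A \<subseteq> (\<Union>k<m. {\<alpha>. mi_deg \<alpha> = Suc k})"
    proof
      fix \<alpha> assume "\<alpha> \<in> A"
      then obtain k where "mi_deg \<alpha> = Suc k" "k < m"
        using m[of \<alpha>] assms(3)[of \<alpha>] by (cases "mi_deg \<alpha>") auto
      then show "\<alpha> \<in> (\<Union>k<m. {\<alpha>. mi_deg \<alpha> = Suc k})" by auto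
    qed
  qed (auto simp: finite_mi_deg_eq)
  also have "\<dots> = (\<Sum>k<m. ?S k)"
    by (rule sum.UNION_disjoint) (auto simp: finite_mi_deg_eq)
  also have "\<dots> \<le> suminf ?S"
    using S(1) by (intro sum_le_suminf) (auto intro: sum_nonneg)
  finally show ?thesis using S(2) by simp
qed

definition single :: "'n \<Rightarrow> nat \<Rightarrow> 'n \<Rightarrow> nat" where
  "single i k = (\<lambda>j. if j = i then k else 0)"

lemma fold_single:
  assumes "distinct js"
  shows "fold (\<lambda>j. D j ^^ single i k j) js F = (if i \<in> set js then (D i ^^ k) F else F)"
  using assms by (induction js arbitrary: F) (auto simp: single_def)

lemma taylor_coeff_single:
  fixes f :: "complex ^ 'n::finite \<Rightarrow> complex"
  shows "taylor_coeff f (single i k) = coeff1 k (\<lambda>w. f (axis i w))"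
proof -
  have "mixed_deriv (single i k) f 0 = (deriv ^^ k) (\<lambda>w. f (axis i w)) 0"
    using higher_partial_deriv[where j = i and k = k and F = f and z = 0 and w = 0]
    by (simp add: mixed_deriv_def fold_single coords axis_eq_0_iff[THEN iffD2])
  moreover have "mi_fact (single i k) = fact k"
  proof -
    have "(\<Prod>j\<in>UNIV. fact (single i k j)) = (\<Prod>j\<in>UNIV. if j = i then fact k else (1 :: nat))"
      by (intro prod.cong) (auto simp: single_def)
    then show ?thesis by (simp add: mi_fact_def)
  qed
  ultimately show ?thesis by (simp add: taylor_coeff_def coeff1_def)
qed

lemma mi_power_single: "mi_power z (single i k) = (z $ i) ^ k"
proof -
  have "mi_power z (single i k) = (\<Prod>j\<in>UNIV. if j = i then (z $ i) ^ k else 1)"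
    unfolding mi_power_def by (intro prod.cong) (auto simp: single_def)
  then show ?thesis by simp
qed

lemma mi_deg_single [simp]: "mi_deg (single i k) = k"
  by (simp add: mi_deg_def single_def)

text \<open>
  A finite Blaschke product with zeros at \<open>0\<close> and \<open>a\<close>; for \<open>a = 1 / sqrt 2\<close> it is extremal for
  the one-variable problem.
\<close>

definition blaschke :: "real \<Rightarrow> complex \<Rightarrow> complex" where
  "blaschke a w = w * Moebius_function 0 (of_real a) w"

lemma coeff1_blaschke:
  assumes "0 < a" "a < 1"
  shows "coeff1 (Suc 0) (blaschke a) = - of_real a"
    and "coeff1 (k + 2) (blaschke a) = of_real ((1 - a\<^sup>2) * a ^ k)"
proof -
  define c :: "nat \<Rightarrow> complex" where
    "c k = (if k = 0 then 0 else if k = 1 then - of_real a else of_real ((1 - a\<^sup>2) * a ^ (k - 2)))" for k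
  have "(\<lambda>k. c k * w ^ k) sums blaschke a w" if w: "norm w < 1" for w
  proof -
    have aw: "norm (of_real a * w) < 1"
      using assms w mult_strict_mono[of a 1 "norm w" 1] by (simp add: norm_mult)
    then have "of_real a * w \<noteq> 1" by auto
    have "(\<lambda>k. of_real (1 - a\<^sup>2) * w\<^sup>2 * (of_real a * w) ^ k) sums (of_real (1 - a\<^sup>2) * w\<^sup>2 * (1 / (1 - of_real a * w)))"
      by (intro sums_mult geometric_sums aw)
    then have "(\<lambda>k. c (k + 2) * w ^ (k + 2)) sums (of_real (1 - a\<^sup>2) * w\<^sup>2 * (1 / (1 - of_real a * w)))"
      by (simp add: c_def power_mult_distrib power_add power2_eq_square mult_ac)
    then have "(\<lambda>k. c k * w ^ k) sums (of_real (1 - a\<^sup>2) * w\<^sup>2 * (1 / (1 - of_real a * w)) + (\<Sum>k<2. c k * w ^ k))"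
      by (subst (asm) sums_iff_shift) auto
    moreover have "of_real (1 - a\<^sup>2) * w\<^sup>2 * (1 / (1 - of_real a * w)) + (\<Sum>k<2. c k * w ^ k) = blaschke a w"
      using \<open>of_real a * w \<noteq> 1\<close>
      by (simp add: c_def numeral_2_eq_2 blaschke_def Moebius_function_simple)
        (simp add: field_simps power2_eq_square)
    ultimately show ?thesis by simp
  qed
  then have c: "coeff1 k (blaschke a) = c k" for k
    by (intro coeff1_unique[of 1]) auto
  show "coeff1 (Suc 0) (blaschke a) = - of_real a"
    and "coeff1 (k + 2) (blaschke a) = of_real ((1 - a\<^sup>2) * a ^ k)"
    by (simp_all add: c) (simp_all add: c_def)
qed

text \<open>
  A function of one coordinate shows that the radius in any dimension is at most the
  one-variable radius. For the Blaschke product with \<open>a = 1 / sqrt 2\<close> the Bohr sum at \<open>r\<close> is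
  \<open>x / (1 - x)\<close> with \<open>x = a * r\<close>, which exceeds 1 as soon as \<open>r > a\<close>.
\<close>

lemma bohr_valid_imp_le_inverse_sqrt_2:
  assumes "bohr_valid TYPE('n::finite) \<rho>"
  shows "\<rho> \<le> 1 / sqrt 2"
proof (rule ccontr)
  define a where "a = 1 / sqrt 2"
  have a: "0 < a" "a < 1" "a\<^sup>2 = 1/2" by (auto simp: a_def power_divide)
  assume "\<not> \<rho> \<le> 1 / sqrt 2"
  then have "a < min \<rho> 1" using a by (simp add: a_def)
  then obtain r where r: "a < r" "r < \<rho>" "r < 1" using dense by (metis min_less_iff_conj)
  then have "0 < \<rho>" "0 < r" using a by auto
  define f where "f = (\<lambda>z :: complex ^ 'n. blaschke a (z $ undefined))"
  define w :: "complex ^ 'n" where "w = (\<chi> j. of_real (r / \<rho>))"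
  have "blaschke a holomorphic_on ball 0 1"
    using a Moebius_function_holomorphic[of "of_real a" 0]
    unfolding blaschke_def [abs_def] by (intro holomorphic_intros) auto
  then have "f multi_holomorphic_on polydisk"
    unfolding f_def by (rule multi_holomorphic_compose_nth)
  moreover have "norm (f z) < 1" if z: "z \<in> polydisk" for z
  proof -
    have "norm (Moebius_function 0 (of_real a) (z $ undefined)) < 1"
      using z a by (intro Moebius_function_norm_lt_1) (auto simp: polydisk_def)
    moreover have "norm (z $ undefined) < 1" using z by (simp add: polydisk_def)
    ultimately show ?thesis
      using mult_strict_mono'[of "norm (z $ undefined)" 1] by (simp add: f_def blaschke_def norm_mult)
  qed
  moreover have "w \<in> polydisk"
    using r \<open>0 < r\<close> \<open>0 < \<rho>\<close> by (simp add: w_def polydisk_def norm_divide)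
  ultimately have ineq: "bohr_ineq f (\<rho> *\<^sub>R w)"
    using assms by (intro bohr_validD) (auto simp: f_def blaschke_def)
  define b where "b k = norm (coeff1 (Suc k) (blaschke a)) * r ^ Suc k" for k
  have term_eq: "norm (taylor_coeff f (single undefined k) * mi_power (\<rho> *\<^sub>R w) (single undefined k))
      = norm (coeff1 k (blaschke a)) * r ^ k" for k
    using \<open>0 < \<rho>\<close> \<open>0 < r\<close>
    by (simp add: taylor_coeff_single mi_power_single f_def w_def norm_mult norm_power norm_divide power_divide)
  have partial: "(\<Sum>k<m. b k) \<le> 1" for m
  proof -
    have inj: "inj_on (\<lambda>k. single (undefined :: 'n) (Suc k)) {..<m}"
      by (rule inj_onI) (metis mi_deg_single nat.inject)
    have "(\<Sum>k<m. b k) = (\<Sum>\<alpha>\<in>(\<lambda>k. single undefined (Suc k)) ` {..<m}. norm (taylor_coeff f \<alpha> * mi_power (\<rho> *\<^sub>R w) \<alpha>))"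
      by (subst sum.reindex[OF inj]) (simp add: term_eq b_def)
    also have "\<dots> \<le> 1" by (intro bohr_ineq_finite_sum ineq) auto
    finally show ?thesis .
  qed
  have ar: "0 < a * r" "a * r < 1" using a r \<open>0 < r\<close> mult_strict_mono[of a 1 r 1] by auto
  have "(\<lambda>k. (1/2) * r\<^sup>2 * (a * r) ^ k) sums ((1/2) * r\<^sup>2 * (1 / (1 - a * r)))"
    using ar by (intro sums_mult geometric_sums) auto
  moreover have "(1/2) * r\<^sup>2 * (a * r) ^ k = b (Suc k)" for k
  proof -
    have "norm (coeff1 (Suc (Suc k)) (blaschke a)) = norm ((1 - a\<^sup>2) * a ^ k)"
      using coeff1_blaschke(2)[OF a(1,2), of k] by (simp only: add_2_eq_Suc' norm_of_real real_norm_def)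
    also have "\<dots> = (1/2) * a ^ k" using a by simp
    finally show ?thesis by (simp add: b_def power_mult_distrib power2_eq_square)
  qed
  ultimately have "(\<lambda>k. b (k + 1)) sums ((1/2) * r\<^sup>2 * (1 / (1 - a * r)))" by simp
  then have "b sums ((1/2) * r\<^sup>2 * (1 / (1 - a * r)) + (\<Sum>k<1. b k))"
    by (subst (asm) sums_iff_shift)
  moreover have "(\<Sum>k<1. b k) = a * r"
    using coeff1_blaschke(1)[OF a(1,2)] a by (simp add: b_def)
  ultimately have "b sums ((1/2) * r\<^sup>2 * (1 / (1 - a * r)) + a * r)" by simp
  then have "(1/2) * r\<^sup>2 * (1 / (1 - a * r)) + a * r \<le> 1"
    unfolding sums_def using partial by (intro LIMSEQ_le_const2) auto
  moreover have "(1/2) * r\<^sup>2 = (a * r)\<^sup>2" using a by (simp add: power_mult_distrib)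
  ultimately have "(a * r)\<^sup>2 * (1 / (1 - a * r)) + a * r \<le> 1" by (simp only:)
  then have "(a * r)\<^sup>2 + a * r * (1 - a * r) \<le> 1 - a * r"
    using ar by (simp add: field_simps)
  then have "a * r \<le> 1/2" by (simp add: algebra_simps power2_eq_square)
  moreover have "a * a < a * r" using a r by (intro mult_strict_left_mono)
  ultimately show False using a(3) by (simp add: power2_eq_square)
qed

section \<open>Taylor coefficients of polynomials\<close>

lemma coeff1_polynomial:
  assumes "finite B"
  shows "coeff1 k (\<lambda>w. \<Sum>\<beta>\<in>B. d \<beta> * w ^ e \<beta>) = (\<Sum>\<beta> | \<beta> \<in> B \<and> e \<beta> = k. d \<beta>)"
proof -
  have "coeff1 k (\<lambda>w. \<Sum>\<beta>\<in>B. d \<beta> * w ^ e \<beta>) = (\<Sum>\<beta>\<in>B. if k = e \<beta> then d \<beta> else 0)"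
  proof (rule coeff1_unique[of 1 "\<lambda>k. \<Sum>\<beta>\<in>B. if k = e \<beta> then d \<beta> else 0"])
    fix w :: complex
    have "(\<lambda>k. \<Sum>\<beta>\<in>B. if k = e \<beta> then d \<beta> * w ^ k else 0) sums (\<Sum>\<beta>\<in>B. d \<beta> * w ^ e \<beta>)"
      by (intro sums_sum sums_single)
    then show "(\<lambda>k. (\<Sum>\<beta>\<in>B. if k = e \<beta> then d \<beta> else 0) * w ^ k) sums (\<Sum>\<beta>\<in>B. d \<beta> * w ^ e \<beta>)"
      by (simp add: sum_distrib_right if_distrib[of "\<lambda>u. u * _"] cong: if_cong)
  qed simp
  also have "\<dots> = (\<Sum>\<beta> | \<beta> \<in> B \<and> e \<beta> = k. d \<beta>)"
    using assms by (simp add: sum.inter_filter eq_commute)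
  finally show ?thesis .
qed

lemma slice_coeff_polynomial:
  fixes F :: "complex ^ 'n::finite \<Rightarrow> complex"
  assumes B: "finite B" and j: "j \<in> S"
    and F: "\<And>z. F z = (\<Sum>\<beta>\<in>B. a \<beta> * (\<Prod>i\<in>S. (z $ i) ^ \<beta> i))"
  shows "slice_coeff j k F z = (\<Sum>\<beta> | \<beta> \<in> B \<and> \<beta> j = k. a \<beta> * (\<Prod>i\<in>S - {j}. (z $ i) ^ \<beta> i))"
proof -
  have "F (vec_upd z j w) = (\<Sum>\<beta>\<in>B. (a \<beta> * (\<Prod>i\<in>S - {j}. (z $ i) ^ \<beta> i)) * w ^ \<beta> j)" for w
  proof -
    have "(\<Prod>i\<in>S. (vec_upd z j w $ i) ^ \<beta> i) = w ^ \<beta> j * (\<Prod>i\<in>S - {j}. (z $ i) ^ \<beta> i)" for \<beta> :: "'n \<Rightarrow> nat"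
      using j by (subst prod.remove[of _ j]) (auto intro!: prod.cong)
    then show ?thesis by (simp add: F mult_ac)
  qed
  then show ?thesis
    unfolding slice_coeff_def by (simp only: coeff1_polynomial[OF B])
qed

text \<open>
  Extracting coefficients in the variables \<open>js\<close> selects the terms with matching exponents
  and deletes these variables from the monomials. The set \<open>S\<close> of variables still present
  has to be general for the induction.
\<close>

lemma iter_coeff_polynomial:
  fixes F :: "complex ^ 'n::finite \<Rightarrow> complex"
  assumes "finite B" "distinct js" "set js \<subseteq> S"
    and "\<And>z. F z = (\<Sum>\<beta>\<in>B. a \<beta> * (\<Prod>i\<in>S. (z $ i) ^ \<beta> i))"
  shows "iter_coeff js \<alpha> F z
    = (\<Sum>\<beta> | \<beta> \<in> B \<and> (\<forall>j\<in>set js. \<beta> j = \<alpha> j). a \<beta> * (\<Prod>i\<in>S - set js. (z $ i) ^ \<beta> i))"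
  using assms
proof (induction js arbitrary: B S F)
  case Nil
  then show ?case by simp
next
  case (Cons j js)
  have "iter_coeff js \<alpha> (slice_coeff j (\<alpha> j) F) z =
    (\<Sum>\<beta> | \<beta> \<in> {\<beta> \<in> B. \<beta> j = \<alpha> j} \<and> (\<forall>j\<in>set js. \<beta> j = \<alpha> j). a \<beta> * (\<Prod>i\<in>S - {j} - set js. (z $ i) ^ \<beta> i))"
    using Cons.prems by (intro Cons.IH slice_coeff_polynomial[where S = S]) auto
  also have "{\<beta>. \<beta> \<in> {\<beta> \<in> B. \<beta> j = \<alpha> j} \<and> (\<forall>j\<in>set js. \<beta> j = \<alpha> j)}
      = {\<beta>. \<beta> \<in> B \<and> (\<forall>j\<in>set (j # js). \<beta> j = \<alpha> j)}"
    by auto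
  also have "S - {j} - set js = S - set (j # js)" by auto
  finally show ?case by simp
qed

lemma taylor_coeff_polynomial:
  fixes f :: "complex ^ 'n::finite \<Rightarrow> complex"
  assumes f: "f multi_holomorphic_on polydisk" "\<And>z. z \<in> polydisk \<Longrightarrow> norm (f z) \<le> 1"
    and B: "finite B" "\<alpha> \<in> B" and poly: "\<And>z. f z = (\<Sum>\<beta>\<in>B. a \<beta> * mi_power z \<beta>)"
  shows "taylor_coeff f \<alpha> = a \<alpha>"
proof -
  have "taylor_coeff f \<alpha> = iter_coeff coords \<alpha> f 0"
    using f by (intro taylor_coeff_eq_iter_coeff multi_holomorphic_imp_sep_holomorphic)
  also have "\<dots> = (\<Sum>\<beta> | \<beta> \<in> B \<and> (\<forall>j\<in>set coords. \<beta> j = \<alpha> j). a \<beta> * (\<Prod>i\<in>UNIV - set coords. ((0 :: complex ^ 'n) $ i) ^ \<beta> i))"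
    using B poly by (intro iter_coeff_polynomial) (auto simp: coords mi_power_def)
  also have "{\<beta>. \<beta> \<in> B \<and> (\<forall>j\<in>set coords. \<beta> j = \<alpha> j)} = {\<alpha>}"
    using B by (auto simp: coords)
  finally show ?thesis by (simp add: coords)
qed

section \<open>A multilinear form with unimodular coefficients\<close>

text \<open>
  A sum over \<open>B\<close> of monomials with coefficients of modulus 1. Only the set of monomials is
  tracked: the Bohr sum does not see the arguments of the coefficients.
\<close>

definition unimodular_poly :: "('n::finite \<Rightarrow> nat) set \<Rightarrow> (complex ^ 'n \<Rightarrow> complex) \<Rightarrow> bool" where
  "unimodular_poly B P \<longleftrightarrow> finite B \<and>
     (\<exists>a. (\<forall>\<beta>\<in>B. norm (a \<beta>) = 1) \<and> (\<forall>z. P z = (\<Sum>\<beta>\<in>B. a \<beta> * mi_power z \<beta>)))"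

lemma unimodular_poly_scale:
  assumes "unimodular_poly B P" "norm c = 1"
  shows "unimodular_poly B (\<lambda>z. c * P z)"
proof -
  obtain a where a: "finite B" "\<forall>\<beta>\<in>B. norm (a \<beta>) = 1" "\<forall>z. P z = (\<Sum>\<beta>\<in>B. a \<beta> * mi_power z \<beta>)"
    using assms unfolding unimodular_poly_def by auto
  then show ?thesis
    unfolding unimodular_poly_def using assms(2)
    by (intro conjI exI[of _ "\<lambda>\<beta>. c * a \<beta>"]) (auto simp: norm_mult sum_distrib_left mult.assoc)
qed

lemma unimodular_poly_sum:
  assumes I: "finite I" and B: "\<And>i. i \<in> I \<Longrightarrow> unimodular_poly (B i) (P i)"
    and disj: "\<And>i j. i \<in> I \<Longrightarrow> j \<in> I \<Longrightarrow> i \<noteq> j \<Longrightarrow> B i \<inter> B j = {}"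
  shows "unimodular_poly (\<Union>i\<in>I. B i) (\<lambda>z. \<Sum>i\<in>I. P i z)"
proof -
  have "\<forall>i\<in>I. \<exists>a. finite (B i) \<and> (\<forall>\<beta>\<in>B i. norm (a \<beta>) = 1) \<and> (\<forall>z. P i z = (\<Sum>\<beta>\<in>B i. a \<beta> * mi_power z \<beta>))"
    using B unfolding unimodular_poly_def by auto
  then obtain a where a: "\<And>i. i \<in> I \<Longrightarrow> finite (B i)" "\<And>i \<beta>. i \<in> I \<Longrightarrow> \<beta> \<in> B i \<Longrightarrow> norm (a i \<beta>) = 1"
    "\<And>i z. i \<in> I \<Longrightarrow> P i z = (\<Sum>\<beta>\<in>B i. a i \<beta> * mi_power z \<beta>)"
    by metis
  define b where "b \<beta> = a (THE i. i \<in> I \<and> \<beta> \<in> B i) \<beta>" for \<beta>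
  have b: "b \<beta> = a i \<beta>" if "i \<in> I" "\<beta> \<in> B i" for i \<beta>
  proof -
    have "(THE i. i \<in> I \<and> \<beta> \<in> B i) = i"
      using that disj by (intro the_equality) auto
    then show ?thesis by (simp add: b_def)
  qed
  have "(\<Sum>i\<in>I. P i z) = (\<Sum>\<beta>\<in>(\<Union>i\<in>I. B i). b \<beta> * mi_power z \<beta>)" for z
    using I a disj b by (subst sum.UNION_disjoint) (auto intro!: sum.cong)
  then show ?thesis
    unfolding unimodular_poly_def using I a b by (intro conjI exI[of _ b]) auto
qed

lemma mi_power_upd:
  assumes "\<beta> i = 0"
  shows "mi_power z (\<beta>(i := 1)) = z $ i * mi_power z \<beta>"
  unfolding mi_power_def using assms
  by (simp add: prod.remove[of UNIV i])

lemma mi_deg_upd: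
  assumes "\<beta> i = 0"
  shows "mi_deg (\<beta>(i := 1)) = Suc (mi_deg \<beta>)"
  unfolding mi_deg_def using assms
  by (simp add: sum.remove[of UNIV i])

lemma inj_on_upd:
  assumes "\<And>\<beta>. \<beta> \<in> B \<Longrightarrow> \<beta> i = (0 :: nat)"
  shows "inj_on (\<lambda>\<beta>. \<beta>(i := 1)) B"
proof (rule inj_onI)
  fix \<beta> \<gamma> assume "\<beta> \<in> B" "\<gamma> \<in> B" "\<beta>(i := 1) = \<gamma>(i := 1)"
  then show "\<beta> = \<gamma>" using assms by (metis fun_upd_triv fun_upd_upd)
qed

lemma unimodular_poly_times_var:
  assumes "unimodular_poly B P" "\<And>\<beta>. \<beta> \<in> B \<Longrightarrow> \<beta> i = 0"
  shows "unimodular_poly ((\<lambda>\<beta>. \<beta>(i := 1)) ` B) (\<lambda>z. z $ i * P z)"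
proof -
  obtain a where a: "finite B" "\<forall>\<beta>\<in>B. norm (a \<beta>) = 1" "\<forall>z. P z = (\<Sum>\<beta>\<in>B. a \<beta> * mi_power z \<beta>)"
    using assms unfolding unimodular_poly_def by auto
  have upd: "\<beta>(i := 0) = \<beta>" if "\<beta> \<in> B" for \<beta>
    using assms(2)[OF that] by (metis fun_upd_triv)
  have "z $ i * P z = (\<Sum>\<beta>\<in>(\<lambda>\<beta>. \<beta>(i := 1)) ` B. a (\<beta>(i := 0)) * mi_power z \<beta>)" for z
    using a assms(2)
    by (subst sum.reindex[OF inj_on_upd])
      (auto simp: sum_distrib_left mi_power_upd upd simp del: One_nat_def intro!: sum.cong)
  then show ?thesis
    unfolding unimodular_poly_def using a upd
    by (intro conjI exI[of _ "\<lambda>\<beta>. a (\<beta>(i := 0))"]) auto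
qed

text \<open>
  With \<open>v t j\<close> the \<open>j\<close>-th variable of the \<open>t\<close>-th block, \<open>chain v N t j\<close> is the \<open>j\<close>-th entry of
  \<open>D_t W D_(t-1) W ... W z_0\<close>, where \<open>W\<close> is the Fourier matrix, \<open>z_0\<close> the vector of variables
  of block 0 and \<open>D_s\<close> the diagonal matrix of the variables of block \<open>s\<close>. Expanded, it is a
  form that is linear in each block, all of whose coefficients are roots of unity, and
  \<open>chain_supp\<close> lists its monomials.
\<close>

fun chain :: "(nat \<Rightarrow> nat \<Rightarrow> 'n::finite) \<Rightarrow> nat \<Rightarrow> nat \<Rightarrow> nat \<Rightarrow> complex ^ 'n \<Rightarrow> complex" where
  "chain v N 0 j z = z $ v 0 j"
| "chain v N (Suc t) j z = z $ v (Suc t) j * (\<Sum>i<N. chain v N t i z * unit_root N ^ (j * i))"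

fun chain_supp :: "(nat \<Rightarrow> nat \<Rightarrow> 'n::finite) \<Rightarrow> nat \<Rightarrow> nat \<Rightarrow> nat \<Rightarrow> ('n \<Rightarrow> nat) set" where
  "chain_supp v N 0 j = {(\<lambda>_. 0)(v 0 j := 1)}"
| "chain_supp v N (Suc t) j = (\<lambda>\<beta>. \<beta>(v (Suc t) j := 1)) ` (\<Union>i<N. chain_supp v N t i)"

lemma multi_holomorphic_chain: "chain v N t j multi_holomorphic_on polydisk"
proof (induction t arbitrary: j)
  case 0
  have "chain v N 0 j = (\<lambda>z. z $ v 0 j)" by (simp add: fun_eq_iff)
  then show ?case by (simp only: multi_holomorphic_nth)
next
  case (Suc t)
  have "(\<lambda>z. z $ v (Suc t) j * (\<Sum>i<N. chain v N t i z * unit_root N ^ (j * i))) multi_holomorphic_on polydisk"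
    using Suc.IH by (intro multi_holomorphic_mult multi_holomorphic_sum multi_holomorphic_nth multi_holomorphic_const)
  moreover have "chain v N (Suc t) j = (\<lambda>z. z $ v (Suc t) j * (\<Sum>i<N. chain v N t i z * unit_root N ^ (j * i)))"
    by (simp add: fun_eq_iff)
  ultimately show ?case by (simp only:)
qed

text \<open>
  The diagonal matrices are contractions and each Fourier matrix contributes a factor
  \<open>sqrt N\<close>.
\<close>

lemma chain_square_sum_less:
  assumes z: "z \<in> polydisk" and N: "N > 0"
  shows "(\<Sum>j<N. (norm (chain v N t j z))\<^sup>2) < real N ^ Suc t"
proof (induction t)
  case 0
  have "(\<Sum>j<N. (norm (chain v N 0 j z))\<^sup>2) < (\<Sum>j<N. 1)"
    using z N by (intro sum_strict_mono) (auto simp: polydisk_def power_less_one_iff abs_square_less_1)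
  then show ?case by simp
next
  case (Suc t)
  have "(\<Sum>j<N. (norm (chain v N (Suc t) j z))\<^sup>2)
      \<le> (\<Sum>j<N. (norm (\<Sum>i<N. chain v N t i z * unit_root N ^ (j * i)))\<^sup>2)"
  proof (intro sum_mono power_mono norm_ge_zero)
    fix j
    show "norm (chain v N (Suc t) j z) \<le> norm (\<Sum>i<N. chain v N t i z * unit_root N ^ (j * i))"
      using z by (auto simp: norm_mult polydisk_def less_imp_le intro: mult_left_le_one_le)
  qed
  also have "\<dots> = real N * (\<Sum>i<N. (norm (chain v N t i z))\<^sup>2)"
    by (rule dft_parseval)
  also have "\<dots> < real N * real N ^ Suc t"
    using N Suc.IH by (intro mult_strict_left_mono) auto
  finally show ?case by simp
qed

text \<open>
  The exponents of the variables in block \<open>t\<close> and later are recorded because they keep the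
  monomials distinct. Those of block \<open>t\<close> reveal \<open>j\<close>, so that different \<open>j\<close> have disjoint
  supports; the later ones vanish, so that a variable of the next block enters to the
  first power. Since no monomials collide, no coefficients can cancel.
\<close>

lemma chain_supp_props:
  assumes inj: "inj_on (\<lambda>(t, j). v t j) ({..<d} \<times> {..<N})" and "t < d" "j < N"
  shows "unimodular_poly (chain_supp v N t j) (chain v N t j) \<and> card (chain_supp v N t j) = N ^ t \<and>
    (\<forall>\<beta>\<in>chain_supp v N t j. mi_deg \<beta> = Suc t \<and>
      (\<forall>s i. t \<le> s \<longrightarrow> s < d \<longrightarrow> i < N \<longrightarrow> \<beta> (v s i) = (if s = t \<and> i = j then 1 else 0)))"
  using assms(2,3)
proof (induction t arbitrary: j)
  case 0
  note v = inj[THEN inj_onD, of "(_, _)" "(_, _)", simplified]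
  have "mi_power z ((\<lambda>_. 0)(v 0 j := 1)) = z $ v 0 j" for z
    by (subst mi_power_upd) (auto simp: mi_power_def)
  then have "unimodular_poly (chain_supp v N 0 j) (chain v N 0 j)"
    by (auto simp: unimodular_poly_def intro!: exI[of _ "\<lambda>_. 1"])
  moreover have "mi_deg ((\<lambda>_. 0)(v 0 j := 1)) = Suc (mi_deg (\<lambda>_ :: 'a. 0))"
    by (rule mi_deg_upd) simp
  then have "mi_deg ((\<lambda>_. 0)(v 0 j := 1)) = Suc 0"
    by (simp only: mi_deg_def sum.neutral_const)
  ultimately show ?case
    using 0 v[of _ _ 0 j] by (auto simp del: fun_upd_apply chain.simps) (auto split: if_splits)
next
  case (Suc t)
  let ?U = "\<Union>i<N. chain_supp v N t i"
  note v = inj[THEN inj_onD, of "(_, _)" "(_, _)", simplified]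
  have t: "t < d" using Suc.prems by simp
  have uni: "unimodular_poly (chain_supp v N t i) (chain v N t i)"
    and card: "card (chain_supp v N t i) = N ^ t"
    and deg: "\<And>\<beta>. \<beta> \<in> chain_supp v N t i \<Longrightarrow> mi_deg \<beta> = Suc t"
    and val: "\<And>\<beta> s k. \<beta> \<in> chain_supp v N t i \<Longrightarrow> t \<le> s \<Longrightarrow> s < d \<Longrightarrow> k < N \<Longrightarrow>
      \<beta> (v s k) = (if s = t \<and> k = i then 1 else 0)"
    if "i < N" for i
    using Suc.IH[OF t that] by simp_all
  have zero: "\<beta> (v s i) = 0" if "\<beta> \<in> ?U" "t < s" "s < d" "i < N" for \<beta> s i
    using that val[of _ \<beta> s i] by auto
  have disj: "chain_supp v N t i \<inter> chain_supp v N t i' = {}" if "i < N" "i' < N" "i \<noteq> i'" for i i'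
  proof (rule ccontr)
    assume "chain_supp v N t i \<inter> chain_supp v N t i' \<noteq> {}"
    then obtain \<beta> where "\<beta> \<in> chain_supp v N t i" "\<beta> \<in> chain_supp v N t i'" by auto
    then have "\<beta> (v t i) = 1" "\<beta> (v t i) = 0"
      using val[of i \<beta> t i] val[of i' \<beta> t i] that t by auto
    then show False by simp
  qed
  have fin: "finite (chain_supp v N t i)" if "i < N" for i
    using uni[OF that] by (simp add: unimodular_poly_def)
  have "unimodular_poly ?U (\<lambda>z. \<Sum>i<N. unit_root N ^ (j * i) * chain v N t i z)"
    using uni disj by (intro unimodular_poly_sum unimodular_poly_scale) (auto simp: norm_power)
  then have "unimodular_poly ((\<lambda>\<beta>. \<beta>(v (Suc t) j := 1)) ` ?U)
      (\<lambda>z. z $ v (Suc t) j * (\<Sum>i<N. unit_root N ^ (j * i) * chain v N t i z))"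
    using Suc.prems by (intro unimodular_poly_times_var zero) auto
  moreover have "chain v N (Suc t) j = (\<lambda>z. z $ v (Suc t) j * (\<Sum>i<N. unit_root N ^ (j * i) * chain v N t i z))"
    by (simp add: fun_eq_iff mult.commute)
  ultimately have "unimodular_poly (chain_supp v N (Suc t) j) (chain v N (Suc t) j)" by simp
  moreover have "card (chain_supp v N (Suc t) j) = N ^ Suc t"
  proof -
    have "card (chain_supp v N (Suc t) j) = card ?U"
      unfolding chain_supp.simps using Suc.prems by (intro card_image inj_on_upd zero) auto
    also have "\<dots> = (\<Sum>i<N. card (chain_supp v N t i))"
      using disj fin by (intro card_UN_disjoint) auto
    finally show ?thesis using card by simp
  qed
  moreover have "mi_deg \<beta> = Suc (Suc t) \<and> (\<forall>s i. Suc t \<le> s \<longrightarrow> s < d \<longrightarrow> i < N \<longrightarrow>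
      \<beta> (v s i) = (if s = Suc t \<and> i = j then 1 else 0))" if \<beta>: "\<beta> \<in> chain_supp v N (Suc t) j" for \<beta>
  proof -
    obtain \<gamma> k where \<gamma>: "k < N" "\<gamma> \<in> chain_supp v N t k" "\<beta> = \<gamma>(v (Suc t) j := 1)"
      using \<beta> by auto
    then have U: "\<gamma> \<in> ?U" by auto
    have "mi_deg \<beta> = Suc (mi_deg \<gamma>)"
      unfolding \<gamma>(3) using zero[OF U] Suc.prems by (intro mi_deg_upd) auto
    then have "mi_deg \<beta> = Suc (Suc t)" using deg \<gamma> by simp
    moreover have "\<beta> (v s i) = (if s = Suc t \<and> i = j then 1 else 0)" if "Suc t \<le> s" "s < d" "i < N" for s i
      using zero[OF U, of s i] v[of s i "Suc t" j] that Suc.prems \<gamma>(3) by auto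
    ultimately show ?thesis by blast
  qed
  ultimately show ?case by blast
qed

text \<open>
  The sum of the entries of the last vector of the chain is a form of degree \<open>d\<close> with
  \<open>N ^ d\<close> unimodular coefficients and, by Cauchy-Schwarz, modulus less than \<open>N ^ ((d + 1) / 2)\<close>. At the point
  with all coordinates \<open>\<rho>\<close>, approached along the diagonal, the Bohr sum of the normalised form is
  \<open>N ^ d * \<rho> ^ d / N ^ ((d + 1) / 2)\<close>, and the claim is the square of the resulting inequality.
\<close>

lemma bohr_valid_imp_power_bound:
  assumes valid: "bohr_valid TYPE('n::finite) \<rho>" and \<rho>: "\<rho> \<ge> 0"
    and d: "d > 0" and N: "N > 0" and dN: "d * N \<le> CARD('n)"
  shows "\<rho> ^ (2 * d) * real N ^ (d - 1) \<le> 1"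
proof -
  have "card ({..<d} \<times> {..<N}) \<le> card (UNIV :: 'n set)" using dN by simp
  then obtain u :: "nat \<times> nat \<Rightarrow> 'n" where u: "inj_on u ({..<d} \<times> {..<N})"
    using card_le_inj[of "{..<d} \<times> {..<N}" "UNIV :: 'n set"] by auto
  define v where "v t j = u (t, j)" for t j
  have inj: "inj_on (\<lambda>(t, j). v t j) ({..<d} \<times> {..<N})"
    using u by (simp add: v_def case_prod_unfold)
  obtain t where t: "d = Suc t" using d by (cases d) auto
  let ?B = "\<Union>j<N. chain_supp v N t j"
  define P where "P z = (\<Sum>j<N. chain v N t j z)" for z
  \<comment> \<open>the normalisation to modulus less than 1\<close>
  define c where "c = 1 / sqrt (real N ^ Suc d)"
  have c: "c > 0" using N by (simp add: c_def)
  have c2: "c\<^sup>2 = 1 / real N ^ Suc d" by (simp add: c_def power_divide)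
  have props: "unimodular_poly (chain_supp v N t i) (chain v N t i)"
    "card (chain_supp v N t i) = N ^ t"
    "\<And>\<beta>. \<beta> \<in> chain_supp v N t i \<Longrightarrow> mi_deg \<beta> = d"
    "\<And>\<beta> k. \<beta> \<in> chain_supp v N t i \<Longrightarrow> k < N \<Longrightarrow> \<beta> (v t k) = (if k = i then 1 else 0)"
    if "i < N" for i
    using chain_supp_props[OF inj _ that, of t] t by simp_all
  have disj: "chain_supp v N t i \<inter> chain_supp v N t i' = {}" if "i < N" "i' < N" "i \<noteq> i'" for i i'
  proof (rule ccontr)
    assume "chain_supp v N t i \<inter> chain_supp v N t i' \<noteq> {}"
    then obtain \<beta> where "\<beta> \<in> chain_supp v N t i" "\<beta> \<in> chain_supp v N t i'" by auto
    then have "\<beta> (v t i) = 1" "\<beta> (v t i) = 0"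
      using props(4)[of i \<beta> i] props(4)[of i' \<beta> i] that by auto
    then show False by simp
  qed
  have uni: "unimodular_poly ?B P"
    unfolding P_def [abs_def] using props(1) disj by (intro unimodular_poly_sum) auto
  then obtain a where a: "finite ?B" "\<forall>\<beta>\<in>?B. norm (a \<beta>) = 1" "\<forall>z. P z = (\<Sum>\<beta>\<in>?B. a \<beta> * mi_power z \<beta>)"
    unfolding unimodular_poly_def by blast
  have card: "card ?B = N ^ d"
  proof -
    have "card ?B = (\<Sum>i<N. card (chain_supp v N t i))"
      using disj props(1) by (intro card_UN_disjoint) (auto simp: unimodular_poly_def)
    then show ?thesis using props(2) t by simp
  qed
  define f where "f z = of_real c * P z" for z :: "complex ^ 'n"
  have hol: "f multi_holomorphic_on polydisk"
    unfolding f_def P_def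
    by (intro multi_holomorphic_mult multi_holomorphic_const multi_holomorphic_sum multi_holomorphic_chain)
  have lt1: "norm (f z) < 1" if z: "z \<in> polydisk" for z
  proof -
    have "(norm (P z))\<^sup>2 \<le> (\<Sum>j<N. 1 * norm (chain v N t j z))\<^sup>2"
      unfolding P_def by (intro power_mono) (auto intro: norm_sum)
    also have "\<dots> \<le> (\<Sum>j<N. 1\<^sup>2) * (\<Sum>j<N. (norm (chain v N t j z))\<^sup>2)"
      by (rule Cauchy_Schwarz_ineq_sum)
    also have "\<dots> < real N * real N ^ d"
      using chain_square_sum_less[OF z N, of v t] N t by simp
    finally have "(norm (f z))\<^sup>2 < 1"
      using N by (simp add: f_def norm_mult power_mult_distrib c2 field_simps)
    then show ?thesis by (simp add: abs_square_less_1)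
  qed
  have poly: "f z = (\<Sum>\<beta>\<in>?B. (of_real c * a \<beta>) * mi_power z \<beta>)" for z
    using a(3) by (simp add: f_def sum_distrib_left mult.assoc)
  have deg: "mi_deg \<beta> = d" if "\<beta> \<in> ?B" for \<beta>
    using that props(3) t by auto
  have coeff: "norm (taylor_coeff f \<beta>) = c" if \<beta>: "\<beta> \<in> ?B" for \<beta>
  proof -
    have "taylor_coeff f \<beta> = of_real c * a \<beta>"
      using hol lt1 by (intro taylor_coeff_polynomial[OF _ _ a(1) \<beta> poly]) (auto intro: less_imp_le)
    moreover have "norm (a \<beta>) = 1" using a(2) \<beta> by blast
    ultimately show ?thesis using c by (simp add: norm_mult)
  qed
  have f0: "f 0 = 0"
  proof -
    have "chain v N t j 0 = 0" for j by (cases t) auto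
    then show ?thesis by (simp add: f_def P_def)
  qed
  have bound: "(\<rho> * s) ^ (2 * d) * real N ^ (d - 1) \<le> 1" if s: "0 < s" "s < 1" for s
  proof -
    define w :: "complex ^ 'n" where "w = (\<chi> j. of_real s)"
    have "w \<in> polydisk" using s by (simp add: w_def polydisk_def)
    then have "bohr_ineq f (\<rho> *\<^sub>R w)"
      using valid hol f0 lt1 by (intro bohr_validD) auto
    then have "(\<Sum>\<beta>\<in>?B. norm (taylor_coeff f \<beta> * mi_power (\<rho> *\<^sub>R w) \<beta>)) \<le> 1"
      using a(1) deg d by (intro bohr_ineq_finite_sum) auto
    moreover have "norm (mi_power (\<rho> *\<^sub>R w) \<beta>) = (\<rho> * s) ^ d" if "\<beta> \<in> ?B" for \<beta>
    proof -
      have "norm (mi_power (\<rho> *\<^sub>R w) \<beta>) = (\<Prod>j\<in>UNIV. (\<rho> * s) ^ \<beta> j)"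
        using \<rho> s by (simp add: mi_power_def w_def norm_mult norm_power power_mult_distrib flip: prod_norm)
      also have "\<dots> = (\<rho> * s) ^ mi_deg \<beta>" by (simp add: mi_deg_def power_sum)
      finally show ?thesis using deg[OF that] by simp
    qed
    ultimately have "real N ^ d * (c * (\<rho> * s) ^ d) \<le> 1"
      using card by (simp add: norm_mult coeff)
    then have "(real N ^ d * (c * (\<rho> * s) ^ d))\<^sup>2 \<le> 1"
      using \<rho> s c by (intro power_le_one) auto
    moreover have "(real N ^ d * (c * (\<rho> * s) ^ d))\<^sup>2 = (real N ^ d)\<^sup>2 * c\<^sup>2 * (\<rho> * s) ^ (2 * d)"
      by (simp add: power_mult_distrib mult_ac flip: power_mult)
    moreover have "(real N ^ d)\<^sup>2 * c\<^sup>2 = real N ^ (d - 1)"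
      unfolding c2 using N t by (simp add: power2_eq_square field_simps)
    ultimately show ?thesis by (simp add: mult.commute)
  qed
  have "((\<lambda>s. (\<rho> * s) ^ (2 * d) * real N ^ (d - 1)) \<longlongrightarrow> (\<rho> * 1) ^ (2 * d) * real N ^ (d - 1)) (at_left (1::real))"
    by (intro tendsto_intros)
  moreover have "\<forall>\<^sub>F s in at_left (1::real). (\<rho> * s) ^ (2 * d) * real N ^ (d - 1) \<le> 1"
    unfolding eventually_at_left[of "0::real" 1, OF zero_less_one] using bound by (intro exI[of _ 0]) auto
  ultimately have "(\<rho> * 1) ^ (2 * d) * real N ^ (d - 1) \<le> 1"
    by (rule tendsto_upperbound) simp
  then show ?thesis by simp
qed

section \<open>The logarithmic upper bound\<close>

lemma exp_1_ge: "5/2 \<le> exp (1 :: real)"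
  using exp_lower_Taylor_quadratic[of "1 :: real"] by simp

lemma exp_ge_square:
  assumes "3 \<le> d"
  shows "2 * (real d - 1)\<^sup>2 \<le> exp (real d)"
  using assms
proof (induction d rule: dec_induct)
  case base
  have "(8 :: real) \<le> (5/2) ^ 3" by (simp add: power3_eq_cube)
  also have "\<dots> \<le> exp 1 ^ 3" by (intro power_mono exp_1_ge) auto
  also have "\<dots> = exp (real 3)" by (simp flip: exp_of_nat_mult)
  finally show ?case by simp
next
  case (step d)
  have "0 \<le> (real d - 3) * (3 * real d - 1) + 2"
    using step by (intro add_nonneg_nonneg mult_nonneg_nonneg) auto
  then have "(real d)\<^sup>2 \<le> 5/2 * (real d - 1)\<^sup>2"
    by (simp add: power2_eq_square algebra_simps)
  then have "2 * (real (Suc d) - 1)\<^sup>2 \<le> 5/2 * (2 * (real d - 1)\<^sup>2)" by simp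
  also have "\<dots> \<le> exp 1 * exp (real d)"
    using step exp_1_ge by (intro mult_mono) auto
  finally show ?case by (simp add: exp_add [symmetric] add.commute)
qed

lemma exp_Suc_le:
  assumes "3 \<le> d"
  shows "exp (real d + 1) \<le> 3/2 * 4 ^ d"
  using assms
proof (induction d rule: dec_induct)
  case base
  have "exp (real 3 + 1) = exp 1 ^ 4" by (simp flip: exp_of_nat_mult)
  also have "\<dots> \<le> (272/100) ^ 4" using e_less_272 by (intro power_mono) auto
  also have "\<dots> \<le> 3/2 * (4::real) ^ 3" by (simp add: power_numeral_reduce)
  finally show ?case .
next
  case (step d)
  have "exp (real (Suc d) + 1) = exp 1 * exp (real d + 1)"
    by (simp add: exp_add [symmetric] add_ac)
  also have "\<dots> \<le> 4 * (3/2 * 4 ^ d)"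
    using step e_less_272 by (intro mult_mono) auto
  finally show ?case by simp
qed

text \<open>
  With \<open>d\<close> the integer part of \<open>log n\<close>, the product equals \<open>4 ^ d * d / n\<close> times
  \<open>(d * (n div d) / n) ^ (d - 1)\<close>. The second factor is the loss from discarding \<open>n mod d\<close>
  variables and is at least 1/2; the first is at least 2 because \<open>n \<le> exp (d + 1)\<close> and 4
  is well above \<open>exp 1\<close>.
\<close>

lemma block_count_estimate:
  fixes n d :: nat
  assumes d: "3 \<le> d" and lo: "exp (real d) \<le> real n" and hi: "real n \<le> exp (real d + 1)"
  shows "1 \<le> (4 * real d / real n) ^ d * real (n div d) ^ (d - 1)"
proof -
  have "0 < real n" using lo exp_gt_zero less_le_trans by blast
  define x where "x = (real d - 1) / real n"
  have dn: "2 * (real d - 1)\<^sup>2 \<le> real n" using exp_ge_square[OF d] lo by linarith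
  have "real d - 1 \<le> 2 * (real d - 1)\<^sup>2"
    using d by (simp add: power2_eq_square)
  then have x1: "x \<le> 1" using dn \<open>0 < real n\<close> by (simp add: x_def)
  have floor: "1 - x \<le> real d * real (n div d) / real n"
  proof -
    have "n = d * (n div d) + n mod d" by simp
    moreover have "n mod d < d" using d by simp
    ultimately have "n + 1 \<le> d * (n div d) + d" by linarith
    then have "real n + 1 \<le> real d * real (n div d) + real d"
      by (metis of_nat_1 of_nat_add of_nat_le_iff of_nat_mult)
    then have "(real n + 1 - real d) / real n \<le> real d * real (n div d) / real n"
      by (intro divide_right_mono) auto
    moreover have "1 - x = (real n + 1 - real d) / real n"
      using \<open>0 < real n\<close> by (simp add: x_def field_simps)
    ultimately show ?thesis by simp
  qed
  have "1 + real (d - 1) * (- x) \<le> (1 + (- x)) ^ (d - 1)"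
    using x1 by (intro Bernoulli_inequality) auto
  also have "\<dots> \<le> (real d * real (n div d) / real n) ^ (d - 1)"
    using floor x1 by (intro power_mono) auto
  finally have "1 - (real d - 1)\<^sup>2 / real n \<le> (real d * real (n div d) / real n) ^ (d - 1)"
    using d by (simp add: x_def power2_eq_square of_nat_diff)
  moreover have "(real d - 1)\<^sup>2 / real n \<le> 1/2"
    using dn \<open>0 < real n\<close> by (simp add: field_simps)
  ultimately have half: "1/2 \<le> (real d * real (n div d) / real n) ^ (d - 1)" by linarith
  have "real n \<le> 3/2 * 4 ^ d" using hi exp_Suc_le[OF d] by linarith
  also have "\<dots> \<le> real d / 2 * 4 ^ d" using d by (intro mult_right_mono) auto
  finally have "1 \<le> (4 ^ d * real d / real n) * (1/2)"
    using \<open>0 < real n\<close> by (simp add: field_simps)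
  also have "\<dots> \<le> (4 ^ d * real d / real n) * (real d * real (n div d) / real n) ^ (d - 1)"
    using half by (intro mult_left_mono) auto
  also have "\<dots> = (4 * real d / real n) ^ d * real (n div d) ^ (d - 1)"
  proof -
    obtain t where "d = Suc t" using d by (cases d) auto
    then show ?thesis
      by (simp only: diff_Suc_1 power_Suc power_mult_distrib power_divide times_divide_times_eq) (simp add: mult_ac)
  qed
  finally show ?thesis .
qed

text \<open>
  The choice \<open>d = floor (log n)\<close> nearly minimises the bound \<open>N ^ (- (d - 1) / d)\<close> for \<open>\<rho> ^ 2\<close>.
  The threshold 21 ensures \<open>d \<ge> 3\<close>.
\<close>

lemma bohr_valid_imp_square_le:
  assumes valid: "bohr_valid TYPE('n::finite) \<rho>" and \<rho>: "\<rho> \<ge> 0" and n: "21 \<le> CARD('n)"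
  shows "\<rho>\<^sup>2 \<le> 4 * ln (real CARD('n)) / real CARD('n)"
proof (rule ccontr)
  define n where "n = CARD('n)"
  define L where "L = ln (real n)"
  define d where "d = nat \<lfloor>L\<rfloor>"
  have "exp (3 :: real) = exp 1 ^ 3" by (simp flip: exp_of_nat_mult)
  also have "\<dots> \<le> (272/100) ^ 3" using e_less_272 by (intro power_mono) auto
  also have "\<dots> \<le> 21" by (simp add: power3_eq_cube)
  also have "\<dots> \<le> real n" using n by (simp add: n_def)
  finally have e3: "exp 3 \<le> real n" .
  have n0: "0 < real n" using e3 exp_gt_zero less_le_trans by blast
  have L3: "3 \<le> L" unfolding L_def using e3 n0 by (simp add: ln_ge_iff)
  then have d: "3 \<le> d" unfolding d_def by (simp add: le_nat_iff le_floor_iff)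
  have dL: "real d \<le> L" "L \<le> real d + 1"
    using L3 unfolding d_def by (simp_all add: of_nat_nat floor_mono)
  have "real n = exp L" using n0 by (simp add: L_def)
  then have lo: "exp (real d) \<le> real n" and hi: "real n \<le> exp (real d + 1)"
    using dL by simp_all
  have "real d < real n" using exp_ge_add_one_self[of "real d"] lo by linarith
  then have N: "0 < n div d" using d by (simp add: div_greater_zero_iff)
  assume "\<not> \<rho>\<^sup>2 \<le> 4 * ln (real CARD('n)) / real CARD('n)"
  then have "4 * L / real n < \<rho>\<^sup>2" by (simp add: L_def n_def)
  moreover have "4 * real d / real n \<le> 4 * L / real n"
    using dL n0 by (intro divide_right_mono) auto
  ultimately have less: "4 * real d / real n < \<rho>\<^sup>2" by linarith
  have "1 \<le> (4 * real d / real n) ^ d * real (n div d) ^ (d - 1)"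
    by (rule block_count_estimate[OF d lo hi])
  also have "\<dots> < (\<rho>\<^sup>2) ^ d * real (n div d) ^ (d - 1)"
    using less d N n0 by (intro mult_strict_right_mono power_strict_mono) auto
  also have "\<dots> = \<rho> ^ (2 * d) * real (n div d) ^ (d - 1)" by (simp add: power_mult)
  also have "\<dots> \<le> 1"
    using d N by (intro bohr_valid_imp_power_bound[OF valid \<rho>]) (auto simp: n_def)
  finally show False by simp
qed

text \<open>
  In small dimensions the logarithmic bound is no better than \<open>1 / sqrt 2\<close>. Exponentiating
  and using \<open>exp 1 \<le> 3\<close> reduces this to \<open>3 ^ n \<le> n ^ 8\<close>.
\<close>

lemma half_le_log_ratio:
  fixes n :: nat
  assumes "3 \<le> n" "n \<le> 20"
  shows "1/2 \<le> 4 * ln (real n) / real n"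
proof -
  have "n = 3 \<or> n = 4 \<or> n = 5 \<or> n = 6 \<or> n = 7 \<or> n = 8 \<or> n = 9 \<or> n = 10 \<or> n = 11 \<or> n = 12 \<or> n = 13 \<or> n = 14 \<or> n = 15 \<or> n = 16 \<or> n = 17 \<or> n = 18 \<or> n = 19 \<or> n = 20"
    using assms by presburger
  then have "(3::real) ^ n \<le> real n ^ 8"
    by (elim disjE) simp_all
  moreover have "exp (real n) \<le> 3 ^ n"
  proof -
    have "exp (real n) = exp 1 ^ n" by (simp flip: exp_of_nat_mult)
    also have "\<dots> \<le> 3 ^ n" using exp_le by (intro power_mono) auto
    finally show ?thesis .
  qed
  ultimately have "exp (real n) \<le> real n ^ 8" by linarith
  then have "real n \<le> ln (real n ^ 8)" using assms by (simp add: ln_ge_iff)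
  then have "real n \<le> 8 * ln (real n)" using assms by (simp add: ln_realpow)
  then show ?thesis using assms by (simp add: field_simps)
qed

theorem theorem3:
  assumes "CARD('n::finite) > 1"
  shows "bohr_radius0 TYPE('n) \<ge> 1 / sqrt (2 * real CARD('n)) \<and>
         bohr_radius0 TYPE('n) \<le>
           (if CARD('n) = 2 then 1 / sqrt 2
            else 2 * sqrt (ln (real CARD('n))) / sqrt (real CARD('n)))"
proof -
  define R where "R = bohr_radius0 TYPE('n)"
  have "0 < 1 / sqrt (2 * real CARD('n))" using assms by simp
  note radius = bohr_radius0_valid[OF bohr_valid_lower this bohr_valid_imp_le_inverse_sqrt_2, folded R_def]
  have lower: "1 / sqrt (2 * real CARD('n)) \<le> R" by (rule radius(2))
  have "0 \<le> 1 / sqrt (2 * real CARD('n))" by simp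
  with lower have R0: "0 \<le> R" by (rule order_trans[rotated])
  have R_le: "R \<le> 1 / sqrt 2" by (rule bohr_valid_imp_le_inverse_sqrt_2[OF radius(1)])
  have "R \<le> 2 * sqrt (ln (real CARD('n))) / sqrt (real CARD('n))" if "CARD('n) \<noteq> 2"
  proof -
    have "R\<^sup>2 \<le> 4 * ln (real CARD('n)) / real CARD('n)"
    proof (cases "21 \<le> CARD('n)")
      case True
      show ?thesis by (rule bohr_valid_imp_square_le[OF radius(1) R0 True])
    next
      case False
      have "R\<^sup>2 \<le> (1 / sqrt 2)\<^sup>2" using R_le R0 by (rule power_mono)
      also have "\<dots> = 1/2" by (simp add: power_divide)
      also have "\<dots> \<le> 4 * ln (real CARD('n)) / real CARD('n)"
        using assms that False by (intro half_le_log_ratio) auto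
      finally show ?thesis .
    qed
    then have "R \<le> sqrt (4 * ln (real CARD('n)) / real CARD('n))" by (rule real_le_rsqrt)
    then show ?thesis by (simp add: real_sqrt_divide real_sqrt_mult)
  qed
  with lower R_le show ?thesis by (simp add: R_def)
qed

end
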